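(* Let $\alpha,\Theta\in\mathcal F_{\overline{\mathcal V}\times\overline{\mathcal V}}$ with $\alpha(y,x)=-\alpha(x,y)$ and $\Theta(x,y)=\Theta(y,x)\ge 0$ for all $x,y\in\overline{\mathcal V}$, and $\alpha(x,y)=0$ for all $x,y\in\mathcal V^{\alpha}_{\mathcal I}$. Let $\Omega\in\mathcal F_{\mathcal V\times\mathcal V}$ be given by $\Omega(x,y)=\Theta(x,y)\alpha^2(x,y)$ if $x\neq y$ and $\Omega(x,x)=\Theta(x,x)$, and let $\lambda\in\mathcal F_{\mathcal V}$ be given by $\lambda(x)=\sum_{y\in\overline{\mathcal V}}\Theta(x,y)\alpha^2(x,y)+\Theta(x,x)$. For a fixed step size $h>0$, let the sequence $(S^k)$ in $\mathcal W$ be given by $$S^{k+1}(x)=\exp_{S^k(x)}\big(h(\Omega S^k)(x)\big),\qquad S^0(x)=\exp_{\mathbb 1_c}\Big(-\frac{D_{\mathcal X}(x)}{\rho}\Big),\qquad x\in\mathcal V .$$ Then the sequence satisfies $$S^{k+1}(x)=\exp_{S^k(x)}\Big(h\Big(\tfrac12\mathcal D^{\alpha}\big(\Theta\,\mathcal G^{\alpha}(\overline S^k)\big)+\lambda\overline S^k\Big)(x)\Big),\qquad x\in\mathcal V,$$ where the zero extension $\overline S^k$ of $S^k$ to $\overline{\mathcal V}$ is a discrete approximation of $S(hk)$, with $S$ the continuous-time solution to the system $$\partial_tS(x,t)=R_{S(x,t)}\Big(\tfrac12\mathcal D^{\alpha}\big(\Theta\,\mathcal G^{\alpha}(S)\big)+\lambda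 S\Big)(x,t)\ \text{ on }\mathcal V\times\mathbb R_+,\qquad \overline S(x,t)=0\ \text{ on }\mathcal V^{\alpha}_{\mathcal I}\times\mathbb R_+,$$ initialized by $S^0(x)$, with imposed zero nonlocal boundary conditions ($\overline S$ being the zero extension of $S$ to $\mathcal V^{\alpha}_{\mathcal I}$). In addition, if $$h\le\frac{1}{|\lambda_{\min}(\Omega)|},$$ where $\lambda_{\min}(\Omega)$ denotes the smallest eigenvalue of $\Omega$, then the sequence $(S^k)$ achieves the monotone decrease property $$J(S^{k+1})\le J(S^k),\qquad k\in\mathbb N,$$ for the potential function $J(S)=-\tfrac12\langle S,\Omega S\rangle$.
   Context: $\mathcal V\subset\mathbb Z^d$ ($d\ge2$) is the vertex set, with $n=|\mathcal V|$ nodes, of an undirected weighted regular grid graph with weights $\Omega$. $\mathcal F_{A}$ is the space of functions $A\to\mathbb R$. For the antisymmetric mapping $\alpha$, which defines the interaction of nodes in $\mathbb Z^d$, $\mathcal V^{\alpha}_{\mathcal I}=\{x\in\mathbb Z^d\setminus\mathcal V:\alpha(x,y)\ne0\text{ for some }y\in\mathcal V\}$ is the nonlocal interaction domain and $\overline{\mathcal V}=\mathcal V\,\dot\cup\,\mathcal V^{\alpha}_{\mathcal I}$. For $F\in\mathcal F_{\overline{\mathcal V}\times\overline{\mathcal V}}$: $\mathcal D^{\alpha}(F)(x)=\sum_{y\in\overline{\mathcal V}}\big(F(x,y)\alpha(x,y)-F(y,x)\alpha(y,x)\big)$, $x\in\overline{\mathcal V}$. For $f\in\mathcal F_{\overline{\mathcal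 V}}$: $\mathcal G^{\alpha}(f)(x,y)=(f(y)-f(x))\alpha(x,y)$. Both act componentwise on vector-valued functions; $\Theta\,\mathcal G^\alpha(f)$ is the pointwise product. In the continuous-time system the nonlocal operators are applied to $S$ extended by zero to $\mathcal V^{\alpha}_{\mathcal I}$. $\mathcal S$ is the relative interior of the probability simplex in $\mathbb R^c$; $\mathcal W$ is the set of $n\times c$ matrices $S$ with rows $S(x)\in\mathcal S$, $x\in\mathcal V$. $R_p=\mathrm{Diag}(p)-pp^\top$ for $p\in\mathcal S$. $\exp_p(v)=\frac{p\odot e^{v}}{\langle p,e^{v}\rangle}$ (componentwise product $\odot$ and exponential), and $\mathbb 1_c=(1,\dots,1)^\top\in\mathbb R^c$. $(\Omega S)(x)=\sum_{y\in\mathcal N(x)}\Omega(x,y)S(y)$ with $\mathcal N(x)=\{y\in\mathcal V:\Omega(x,y)>0\}$, and $\langle S,\Omega S\rangle=\sum_{x\in\mathcal V}\langle S(x),(\Omega S)(x)\rangle$. $D_{\mathcal X}(x)=\big(d_{\mathcal X}(X(x),X_1^\ast),\dots,d_{\mathcal X}(X(x),X_c^\ast)\big)^\top$ is the vector of distances, in a metric space $(\mathcal X,d_{\mathcal X})$, from the datum $X(x)\in\mathcal X$ given at $x\in\mathcal V$ to $c$ prototypes $X_1^\ast,\dots,X_c^\ast\in\mathcal X$, and $\rho>0$ is a scaling parameter. *)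

theory Defs
  imports "HOL-Analysis.Analysis"
begin

text \<open>Functions on a subset of the integer lattice are represented by total functions on
  \<open>int ^ 'd\<close> of which only the values on the respective subset are used.\<close>

type_synonym 'd lattice = "int ^ 'd"


section \<open>Nonlocal operators\<close>

definition interaction_domain :: "'v set \<Rightarrow> ('v \<Rightarrow> 'v \<Rightarrow> real) \<Rightarrow> 'v set" where
  "interaction_domain V \<alpha> = {x. x \<notin> V \<and> (\<exists>y\<in>V. \<alpha> x y \<noteq> 0)}"

definition extended_domain :: "'v set \<Rightarrow> ('v \<Rightarrow> 'v \<Rightarrow> real) \<Rightarrow> 'v set" where
  "extended_domain V \<alpha> = V \<union> interaction_domain V \<alpha>"

definition nonlocal_div ::
    "'v set \<Rightarrow> ('v \<Rightarrow> 'v \<Rightarrow> real) \<Rightarrow> ('v \<Rightarrow> 'v \<Rightarrow> 'b::real_vector) \<Rightarrow> 'v \<Rightarrow> 'b" where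
  "nonlocal_div V \<alpha> F x =
     (\<Sum>y\<in>extended_domain V \<alpha>. \<alpha> x y *\<^sub>R F x y - \<alpha> y x *\<^sub>R F y x)"

definition nonlocal_grad ::
    "('v \<Rightarrow> 'v \<Rightarrow> real) \<Rightarrow> ('v \<Rightarrow> 'b::real_vector) \<Rightarrow> 'v \<Rightarrow> 'v \<Rightarrow> 'b" where
  "nonlocal_grad \<alpha> f x y = \<alpha> x y *\<^sub>R (f y - f x)"

definition zero_extension :: "'v set \<Rightarrow> ('v \<Rightarrow> 'b::zero) \<Rightarrow> 'v \<Rightarrow> 'b" where
  "zero_extension V f x = (if x \<in> V then f x else 0)"

text \<open>The argument \<open>f\<close> is a function on the extended domain.\<close>

definition nonlocal_field ::
    "'v set \<Rightarrow> ('v \<Rightarrow> 'v \<Rightarrow> real) \<Rightarrow> ('v \<Rightarrow> 'v \<Rightarrow> real) \<Rightarrow> ('v \<Rightarrow> real) \<Rightarrow>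
     ('v \<Rightarrow> 'b::real_vector) \<Rightarrow> 'v \<Rightarrow> 'b" where
  "nonlocal_field V \<alpha> \<Theta> lam f x =
     (1/2) *\<^sub>R nonlocal_div V \<alpha> (\<lambda>y z. \<Theta> y z *\<^sub>R nonlocal_grad \<alpha> f y z) x + lam x *\<^sub>R f x"


section \<open>Assignment manifold\<close>

definition open_simplex :: "(real ^ 'c) set" where
  "open_simplex = rel_interior {p. (\<forall>j. 0 \<le> p $ j) \<and> (\<Sum>j\<in>UNIV. p $ j) = 1}"

definition assignment_manifold :: "'v set \<Rightarrow> ('v \<Rightarrow> real ^ 'c) set" where
  "assignment_manifold V = {S. \<forall>x\<in>V. S x \<in> open_simplex}"

definition replicator :: "real ^ 'c \<Rightarrow> real ^ 'c ^ 'c" where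
  "replicator p = (\<chi> i j. (if i = j then p $ i else 0) - p $ i * p $ j)"

text \<open>The formula is also used for \<open>p = 1\<close>, the all-ones vector, which is not in the simplex
  unless \<open>CARD('c) = 1\<close>.\<close>

definition lifting_exp :: "real ^ 'c \<Rightarrow> real ^ 'c \<Rightarrow> real ^ 'c" where
  "lifting_exp p v =
     (let e = (\<chi> j. exp (v $ j)) in (1 / (p \<bullet> e)) *\<^sub>R (\<chi> j. p $ j * e $ j))"

definition distance_vector ::
    "('v \<Rightarrow> 'm::metric_space) \<Rightarrow> ('c \<Rightarrow> 'm) \<Rightarrow> 'v \<Rightarrow> real ^ 'c" where
  "distance_vector X P x = (\<chi> j. dist (X x) (P j))"


section \<open>Weights and potential\<close>

definition neighbours :: "'v set \<Rightarrow> ('v \<Rightarrow> 'v \<Rightarrow> real) \<Rightarrow> 'v \<Rightarrow> 'v set" where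
  "neighbours V \<Omega> x = {y \<in> V. \<Omega> x y > 0}"

definition averaging ::
    "'v set \<Rightarrow> ('v \<Rightarrow> 'v \<Rightarrow> real) \<Rightarrow> ('v \<Rightarrow> 'b::real_vector) \<Rightarrow> 'v \<Rightarrow> 'b" where
  "averaging V \<Omega> S x = (\<Sum>y\<in>neighbours V \<Omega> x. \<Omega> x y *\<^sub>R S y)"

definition potential ::
    "'v set \<Rightarrow> ('v \<Rightarrow> 'v \<Rightarrow> real) \<Rightarrow> ('v \<Rightarrow> 'b::real_inner) \<Rightarrow> real" where
  "potential V \<Omega> S = - (1/2) * (\<Sum>x\<in>V. S x \<bullet> averaging V \<Omega> S x)"

text \<open>Only real eigenvalues are considered; the weight matrices below are symmetric.\<close>

definition is_eigenvalue :: "'v set \<Rightarrow> ('v \<Rightarrow> 'v \<Rightarrow> real) \<Rightarrow> real \<Rightarrow> bool" where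
  "is_eigenvalue V A \<mu> \<longleftrightarrow>
     (\<exists>f. (\<exists>x\<in>V. f x \<noteq> 0) \<and> (\<forall>x\<in>V. (\<Sum>y\<in>V. A x y * f y) = \<mu> * f x))"

definition min_eigenvalue :: "'v set \<Rightarrow> ('v \<Rightarrow> 'v \<Rightarrow> real) \<Rightarrow> real" where
  "min_eigenvalue V A = (LEAST \<mu>. is_eigenvalue V A \<mu>)"


section \<open>Continuous-time system\<close>

text \<open>\<open>S\<close> takes values on the whole extended domain, so that the nonlocal boundary condition is
  part of the system. At \<open>t = 0\<close> the derivative is one-sided.\<close>

definition solves_nonlocal_system ::
    "'v set \<Rightarrow> ('v \<Rightarrow> 'v \<Rightarrow> real) \<Rightarrow> ('v \<Rightarrow> 'v \<Rightarrow> real) \<Rightarrow> ('v \<Rightarrow> real) \<Rightarrow>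
     ('v \<Rightarrow> real ^ 'c) \<Rightarrow> (real \<Rightarrow> 'v \<Rightarrow> real ^ 'c) \<Rightarrow> bool" where
  "solves_nonlocal_system V \<alpha> \<Theta> lam S0 S \<longleftrightarrow>
     (\<forall>t\<ge>0. S t \<in> assignment_manifold V) \<and>
     (\<forall>x\<in>V. S 0 x = S0 x) \<and>
     (\<forall>t\<ge>0. \<forall>x\<in>V. ((\<lambda>s. S s x) has_vector_derivative
        replicator (S t x) *v nonlocal_field V \<alpha> \<Theta> lam (S t) x) (at t within {0..})) \<and>
     (\<forall>t\<ge>0. \<forall>x\<in>interaction_domain V \<alpha>. S t x = 0)"

end

theory Submission
  imports Defs
begin

text \<open>
  The nonlocal field with zero boundary values is the averaging operator in disguise. Since
  \<open>\<alpha>\<close> is antisymmetric and \<open>\<Theta>\<close> symmetric, half the divergence of the weighted gradient of \<open>f\<close> at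
  \<open>x\<close> is the sum of \<open>\<Theta> x y * (\<alpha> x y)\<^sup>2\<close> times \<open>f y - f x\<close>; the term \<open>lam x\<close> cancels
  the contribution of \<open>f x\<close> except for \<open>\<Theta> x x\<close>, and the boundary contributes nothing
  (\<open>nonlocal_field_eq_averaging\<close>).

  The differential equation is solved, and its relation to the scheme explained, by lifting both
  from the simplex to a linear space. Write \<open>\<sigma> v\<close> for \<open>lifting_exp 1 v\<close>, the softmax of \<open>v\<close>.
  Its derivative is the replicator matrix at \<open>\<sigma> v\<close> (\<open>lifting_exp_has_derivative\<close>), and
  \<open>lifting_exp\<close> turns addition of tangent vectors into composition (\<open>lifting_exp_add\<close>). Hence, if
  \<open>v\<close> solves the equation \<open>v' = \<Omega> \<sigma>(v)\<close>, then \<open>\<sigma>(v)\<close> solves the replicator system, and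
  \<open>\<sigma>\<close> applied to the explicit Euler iterates of that equation is exactly the given scheme. The
  lifted field is bounded and globally Lipschitz, which gives a solution for all times by Picard
  iteration (\<open>lipschitz_field_solution_exists\<close>) and the classical error bound of first order in
  \<open>h\<close> (\<open>euler_scheme_error\<close>); both descend through \<open>\<sigma>\<close>, which is Lipschitz as well. Uniqueness is
  proved on the simplex itself, where the replicator field is Lipschitz, by a Gronwall argument
  (\<open>lipschitz_solution_unique\<close>).

  For the potential, put \<open>d = q - p\<close> for one step from \<open>p\<close> to \<open>q\<close>. Expanding the quadratic form
  gives a linear term \<open>2 \<langle>d, \<Omega> p\<rangle>\<close> and a quadratic term \<open>\<langle>d, \<Omega> d\<rangle>\<close>. The vector
  \<open>h \<Omega> p\<close> is, up to constants that are orthogonal to \<open>d\<close>, the difference of the logarithms of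
  \<open>q\<close> and \<open>p\<close>; as all entries are at most 1, this makes \<open>h \<langle>d, \<Omega> p\<rangle>\<close> at least the squared
  norm of \<open>d\<close> (\<open>lifting_exp_ascent\<close>). The quadratic term is at least the smallest eigenvalue
  times the squared norm of \<open>d\<close> (\<open>min_eigenvalue_le_form_cart\<close>), so the step size condition keeps
  the sum nonnegative.
\<close>

section \<open>The lifting map and the replicator operator\<close>

lemma lifting_exp_component:
  "lifting_exp p v $ j = p $ j * exp (v $ j) / (\<Sum>i\<in>UNIV. p $ i * exp (v $ i))"
  by (simp add: lifting_exp_def inner_vec_def)

lemma sum_exp_pos:
  fixes p :: "real ^ 'c::finite"
  assumes "\<And>j. 0 < p $ j"
  shows "0 < (\<Sum>i\<in>UNIV. p $ i * exp (v $ i))"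
  using assms by (intro sum_pos) auto

lemma lifting_exp_pos:
  assumes "\<And>j. 0 < p $ j"
  shows "0 < lifting_exp p v $ j"
  using assms sum_exp_pos[OF assms] by (simp add: lifting_exp_component)

lemma lifting_exp_sum_1:
  assumes "\<And>j. 0 < p $ j"
  shows "(\<Sum>j\<in>UNIV. lifting_exp p v $ j) = 1"
  using sum_exp_pos[OF assms, of v]
  by (simp add: lifting_exp_component flip: sum_divide_distrib)

text \<open>The normalization constants of the two steps cancel. This is why iterating the scheme
  amounts to adding up the directions before a single normalization.\<close>

lemma lifting_exp_add:
  assumes "\<And>j. 0 < p $ j"
  shows "lifting_exp (lifting_exp p v) w = lifting_exp p (v + w)"
proof -
  define Z where "Z = (\<Sum>i\<in>UNIV. p $ i * exp (v $ i))"
  have Z: "Z \<noteq> 0"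
    using sum_exp_pos[OF assms, of v] by (simp add: Z_def)
  have "(\<Sum>i\<in>UNIV. lifting_exp p v $ i * exp (w $ i)) = (\<Sum>i\<in>UNIV. p $ i * exp ((v + w) $ i)) / Z"
    by (simp add: lifting_exp_component sum_divide_distrib exp_add mult.assoc flip: Z_def)
  then show ?thesis
    using Z by (simp add: vec_eq_iff lifting_exp_component[of "lifting_exp p v"]
        lifting_exp_component[of p "v + w"])
      (simp add: lifting_exp_component exp_add flip: Z_def)
qed

lemma open_simplexI:
  fixes p :: "real ^ 'c"
  assumes pos: "\<And>j. 0 < p $ j" and sum: "(\<Sum>j\<in>UNIV. p $ j) = 1"
  shows "p \<in> open_simplex"
proof -
  let ?D = "{p :: real ^ 'c. (\<forall>j. 0 \<le> p $ j) \<and> (\<Sum>j\<in>UNIV. p $ j) = 1}"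
  let ?H = "{p :: real ^ 'c. (\<Sum>j\<in>UNIV. p $ j) = 1}"
  let ?T = "{p :: real ^ 'c. \<forall>j. 0 < p $ j}"
  have "affine ?H"
    by (auto simp: affine_def sum.distrib simp flip: sum_distrib_left)
  then have hull: "affine hull ?D \<subseteq> ?H"
    by (intro hull_minimal) auto
  have "open ?T"
    unfolding Collect_all_eq by (intro open_INT finite ballI open_Collect_less continuous_intros)
  moreover have "p \<in> ?T \<inter> ?D"
    using pos sum by (auto intro: less_imp_le)
  moreover have "?T \<inter> affine hull ?D \<subseteq> ?D"
    using hull by (auto intro: less_imp_le)
  ultimately show ?thesis
    unfolding open_simplex_def mem_rel_interior by blast
qed

lemma open_simplexD:
  assumes "p \<in> open_simplex"
  shows "0 \<le> p $ j" and "(\<Sum>j\<in>UNIV. p $ j) = 1"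
  using assms rel_interior_subset unfolding open_simplex_def by blast+

text \<open>The Euclidean norm is bounded by the sum of the entries.\<close>

lemma norm_simplex_le_1:
  fixes p :: "real ^ 'c"
  assumes "\<And>j. 0 \<le> p $ j" and "(\<Sum>j\<in>UNIV. p $ j) = 1"
  shows "norm p \<le> 1"
  using norm_le_l1_cart[of p] assms by simp

lemma lifting_exp_in_open_simplex:
  assumes "\<And>j. 0 < p $ j"
  shows "lifting_exp p v \<in> open_simplex"
  using assms by (intro open_simplexI lifting_exp_pos lifting_exp_sum_1)

lemma open_simplex_norm_le_1: "p \<in> open_simplex \<Longrightarrow> norm p \<le> 1"
  by (simp add: norm_simplex_le_1 open_simplexD)

lemma replicator_mult: "(replicator p *v u) $ i = p $ i * (u $ i - p \<bullet> u)"
proof -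
  have "(replicator p *v u) $ i = (\<Sum>j\<in>UNIV. (if i = j then p $ i * u $ j else 0) - p $ i * (p $ j * u $ j))"
    unfolding replicator_def matrix_vector_mult_def
    by (auto intro!: sum.cong simp: algebra_simps)
  also have "\<dots> = p $ i * u $ i - p $ i * (p \<bullet> u)"
    by (simp add: sum_subtractf inner_vec_def flip: sum_distrib_left)
  finally show ?thesis
    by (simp add: algebra_simps)
qed

text \<open>The operator norm of a diagonal matrix is its largest absolute entry, which is at most the norm of the
  diagonal.\<close>

lemma norm_hadamard_le:
  fixes p u :: "real ^ 'c"
  shows "norm (\<chi> i. p $ i * u $ i) \<le> norm p * norm u"
proof -
  have "norm (\<chi> i. p $ i * u $ i) \<le> norm (norm u *\<^sub>R p)"
    by (rule norm_le_componentwise_cart)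
      (simp add: abs_mult mult.commute[of "norm u"] mult_left_mono component_le_norm_cart)
  then show ?thesis
    by (simp add: mult.commute)
qed

lemma replicator_eq_hadamard:
  "replicator p *v u = (\<chi> i. p $ i * u $ i) - (p \<bullet> u) *\<^sub>R p"
  by (simp add: vec_eq_iff replicator_mult algebra_simps)

lemma norm_replicator_le:
  fixes p u :: "real ^ 'c"
  assumes "norm p \<le> 1"
  shows "norm (replicator p *v u) \<le> 2 * norm u"
proof -
  have "norm (replicator p *v u) \<le> norm (\<chi> i. p $ i * u $ i) + norm ((p \<bullet> u) *\<^sub>R p)"
    unfolding replicator_eq_hadamard by (rule norm_triangle_ineq4)
  also have "\<dots> \<le> norm p * norm u + (norm p * norm u) * norm p"
    using norm_hadamard_le[of p u] Cauchy_Schwarz_ineq2[of p u]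
    by (intro add_mono) (simp_all add: mult_right_mono)
  also have "\<dots> \<le> 1 * norm u + (1 * norm u) * 1"
    using assms by (intro add_mono mult_mono) auto
  finally show ?thesis by simp
qed

text \<open>The replicator matrix is quadratic in \<open>p\<close>, hence Lipschitz on the unit ball; each of its
  summands contributes a multiple of \<open>norm u * norm (p - q)\<close>.\<close>

lemma norm_replicator_diff_le:
  fixes p q u :: "real ^ 'c"
  assumes "norm p \<le> 1" and "norm q \<le> 1"
  shows "norm (replicator p *v u - replicator q *v u) \<le> 3 * norm u * norm (p - q)"
proof -
  have "replicator p *v u - replicator q *v u
      = (\<chi> i. (p - q) $ i * u $ i) - (p \<bullet> u) *\<^sub>R (p - q) - ((p - q) \<bullet> u) *\<^sub>R q"
    by (simp add: vec_eq_iff replicator_mult inner_diff_left algebra_simps)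
  also have "norm \<dots> \<le> norm (\<chi> i. (p - q) $ i * u $ i) + norm ((p \<bullet> u) *\<^sub>R (p - q))
      + norm (((p - q) \<bullet> u) *\<^sub>R q)"
    by (meson add_mono norm_triangle_ineq4 order.refl order_trans)
  also have "\<dots> \<le> norm (p - q) * norm u + (norm p * norm u) * norm (p - q)
      + (norm (p - q) * norm u) * norm q"
    using norm_hadamard_le[of "p - q" u] Cauchy_Schwarz_ineq2[of p u]
      Cauchy_Schwarz_ineq2[of "p - q" u]
    by (intro add_mono) (simp_all add: mult_right_mono)
  also have "\<dots> \<le> norm (p - q) * norm u + (1 * norm u) * norm (p - q)
      + (norm (p - q) * norm u) * 1"
    using assms by (intro add_mono mult_mono) auto
  finally show ?thesis by (simp add: algebra_simps)
qed

lemma has_vector_derivative_cartI: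
  fixes f :: "real \<Rightarrow> real ^ 'n"
  assumes "\<And>i. ((\<lambda>t. f t $ i) has_real_derivative f' $ i) (at t within A)"
  shows "(f has_vector_derivative f') (at t within A)"
  unfolding has_vector_derivative_def
proof (subst has_derivative_componentwise_within, intro ballI)
  fix b :: "real ^ 'n" assume "b \<in> Basis"
  then obtain i where b: "b = axis i 1"
    by (auto simp: Basis_vec_def)
  show "((\<lambda>t. f t \<bullet> b) has_derivative (\<lambda>h. (h *\<^sub>R f') \<bullet> b)) (at t within A)"
    using assms[of i] by (simp add: b inner_axis has_field_derivative_def mult_commute_abs)
qed

lemma has_real_derivative_cart_nth:
  fixes f :: "real \<Rightarrow> real ^ 'n"
  assumes "(f has_vector_derivative f') (at t within A)"
  shows "((\<lambda>t. f t $ i) has_real_derivative f' $ i) (at t within A)"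
  using bounded_linear.has_vector_derivative[OF bounded_linear_vec_nth assms]
  by (simp add: has_real_derivative_iff_has_vector_derivative)

text \<open>The replicator matrix is the Jacobian of the softmax map: by the quotient rule, the change of
  the normalization subtracts the mean of \<open>w\<close> under the current distribution.\<close>

lemma lifting_exp_has_derivative:
  fixes v :: "real \<Rightarrow> real ^ 'c"
  assumes v: "(v has_vector_derivative w) (at t within A)" and pos: "\<And>j. 0 < p $ j"
  shows "((\<lambda>s. lifting_exp p (v s)) has_vector_derivative
           replicator (lifting_exp p (v t)) *v w) (at t within A)"
proof (rule has_vector_derivative_cartI)
  fix i
  define Z where "Z s = (\<Sum>j\<in>UNIV. p $ j * exp (v s $ j))" for s
  have Z: "Z s > 0" for s
    unfolding Z_def by (rule sum_exp_pos[OF pos])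
  have vi: "((\<lambda>s. v s $ j) has_real_derivative w $ j) (at t within A)" for j
    by (rule has_real_derivative_cart_nth[OF v])
  have ve: "((\<lambda>s. exp (v s $ j)) has_real_derivative exp (v t $ j) * w $ j) (at t within A)" for j
    by (auto intro!: derivative_eq_intros vi)
  define N where "N = (\<Sum>j\<in>UNIV. p $ j * (exp (v t $ j) * w $ j))"
  have dZ: "(Z has_real_derivative N) (at t within A)"
    unfolding Z_def N_def by (intro DERIV_sum DERIV_cmult ve)
  have inner: "lifting_exp p (v t) \<bullet> w = N / Z t"
    by (simp add: inner_vec_def lifting_exp_component sum_divide_distrib N_def mult.assoc flip: Z_def)
  have "((\<lambda>s. p $ i * exp (v s $ i) / Z s) has_real_derivative
      (p $ i * (exp (v t $ i) * w $ i) * Z t - p $ i * exp (v t $ i) * N) / (Z t * Z t))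
      (at t within A)"
    using Z[of t] by (intro DERIV_divide DERIV_cmult ve dZ) auto
  moreover have "(p $ i * (exp (v t $ i) * w $ i) * Z t - p $ i * exp (v t $ i) * N) / (Z t * Z t)
      = (replicator (lifting_exp p (v t)) *v w) $ i"
    using Z[of t] unfolding replicator_mult inner
    by (simp add: lifting_exp_component field_simps flip: Z_def)
  ultimately show "((\<lambda>s. lifting_exp p (v s) $ i) has_real_derivative
      (replicator (lifting_exp p (v t)) *v w) $ i) (at t within A)"
    by (simp add: lifting_exp_component flip: Z_def)
qed

lemma vector_differentiable_bound:
  fixes f :: "real \<Rightarrow> 'b::real_normed_vector"
  assumes "convex A" and "\<And>t. t \<in> A \<Longrightarrow> (f has_vector_derivative f' t) (at t within A)"
    and "\<And>t. t \<in> A \<Longrightarrow> norm (f' t) \<le> B" and "s \<in> A" and "t \<in> A"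
  shows "norm (f s - f t) \<le> B * \<bar>s - t\<bar>"
proof -
  have "norm (f s - f t) \<le> B * norm (s - t)"
  proof (rule differentiable_bound[OF \<open>convex A\<close> _ _ \<open>s \<in> A\<close> \<open>t \<in> A\<close>])
    show "(f has_derivative (\<lambda>h. h *\<^sub>R f' t)) (at t within A)" if "t \<in> A" for t
      using assms(2)[OF that] by (simp add: has_vector_derivative_def)
    show "onorm (\<lambda>h. h *\<^sub>R f' t) \<le> B" if "t \<in> A" for t
      by (rule onorm_le) (use assms(3)[OF that] in \<open>simp add: mult.commute[of B] mult_left_mono\<close>)
  qed
  then show ?thesis by simp
qed

text \<open>The values lie in the simplex, so the Jacobian has operator norm at most 2 along the whole
  segment from \<open>w\<close> to \<open>v\<close>.\<close>

lemma lifting_exp_Lipschitz: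
  fixes p v w :: "real ^ 'c"
  assumes pos: "\<And>j. 0 < p $ j"
  shows "norm (lifting_exp p v - lifting_exp p w) \<le> 2 * norm (v - w)"
proof -
  define c where "c s = w + s *\<^sub>R (v - w)" for s :: real
  have "norm (lifting_exp p (c 1) - lifting_exp p (c 0)) \<le> 2 * norm (v - w) * \<bar>1 - 0\<bar>"
  proof (rule vector_differentiable_bound)
    fix s :: real
    have "(c has_vector_derivative v - w) (at s within {0..1})"
      unfolding c_def by (auto intro!: derivative_eq_intros)
    then show "((\<lambda>s. lifting_exp p (c s)) has_vector_derivative
        replicator (lifting_exp p (c s)) *v (v - w)) (at s within {0..1})"
      by (rule lifting_exp_has_derivative[OF _ pos])
    show "norm (replicator (lifting_exp p (c s)) *v (v - w)) \<le> 2 * norm (v - w)"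
      by (intro norm_replicator_le open_simplex_norm_le_1 lifting_exp_in_open_simplex pos)
  qed auto
  then show ?thesis by (simp add: c_def)
qed

section \<open>Lipschitz systems of ordinary differential equations\<close>

text \<open>Functions on the finite set \<open>V\<close> are total functions of which only the values on \<open>V\<close> count;
  these do not form a normed type, so their distance is made explicit. Summing norms rather than
  taking a maximum lets it commute with integration.\<close>

definition l1dist :: "'v set \<Rightarrow> ('v \<Rightarrow> 'b::real_normed_vector) \<Rightarrow> ('v \<Rightarrow> 'b) \<Rightarrow> real" where
  "l1dist V u w = (\<Sum>x\<in>V. norm (u x - w x))"

definition lipschitz_field ::
    "'v set \<Rightarrow> real \<Rightarrow> (('v \<Rightarrow> 'b::real_normed_vector) \<Rightarrow> 'v \<Rightarrow> 'b) \<Rightarrow> bool" where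
  "lipschitz_field V L g \<longleftrightarrow> 0 \<le> L \<and> (\<forall>u w. l1dist V (g u) (g w) \<le> L * l1dist V u w)"

lemma l1dist_nonneg: "0 \<le> l1dist V u w"
  by (simp add: l1dist_def sum_nonneg)

lemma norm_le_l1dist: "finite V \<Longrightarrow> x \<in> V \<Longrightarrow> norm (u x - w x) \<le> l1dist V u w"
  unfolding l1dist_def by (rule member_le_sum) auto

lemma lipschitz_field_norm_le:
  assumes "finite V" and "lipschitz_field V L g" and "x \<in> V"
  shows "norm (g u x - g w x) \<le> L * l1dist V u w"
  using norm_le_l1dist[OF assms(1,3), of "g u" "g w"] assms(2)
  unfolding lipschitz_field_def by (meson order_trans)

lemma continuous_on_lipschitz_field:
  fixes u :: "real \<Rightarrow> 'v \<Rightarrow> 'b::real_normed_vector"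
  assumes V: "finite V" and g: "lipschitz_field V L g" and x: "x \<in> V"
    and u: "\<And>y. y \<in> V \<Longrightarrow> continuous_on A (\<lambda>t. u t y)"
  shows "continuous_on A (\<lambda>t. g (u t) x)"
  unfolding continuous_on_def
proof
  fix t assume t: "t \<in> A"
  have "((\<lambda>s. u s y) \<longlongrightarrow> u t y) (at t within A)" if "y \<in> V" for y
    using u[OF that] t unfolding continuous_on_def by blast
  then have "((\<lambda>s. L * l1dist V (u s) (u t)) \<longlongrightarrow> L * l1dist V (u t) (u t)) (at t within A)"
    unfolding l1dist_def by (intro tendsto_intros)
  then have "((\<lambda>s. L * l1dist V (u s) (u t)) \<longlongrightarrow> 0) (at t within A)"
    by (simp add: l1dist_def)
  then have "((\<lambda>s. g (u s) x - g (u t) x) \<longlongrightarrow> 0) (at t within A)"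
    by (rule Lim_null_comparison[rotated])
      (intro always_eventually allI lipschitz_field_norm_le[OF V g x])
  then show "((\<lambda>s. g (u s) x) \<longlongrightarrow> g (u t) x) (at t within A)"
    by (rule LIM_zero_cancel)
qed

primrec picard ::
    "('v \<Rightarrow> 'b::banach) \<Rightarrow> (('v \<Rightarrow> 'b) \<Rightarrow> 'v \<Rightarrow> 'b) \<Rightarrow> nat \<Rightarrow> real \<Rightarrow> 'v \<Rightarrow> 'b" where
  "picard u0 g 0 t = u0"
| "picard u0 g (Suc n) t = (\<lambda>x. u0 x + integral {0..t} (\<lambda>s. g (picard u0 g n s) x))"

declare picard.simps(2) [simp del]

lemma continuous_on_picard:
  assumes "finite V" and "lipschitz_field V L g" and "x \<in> V"
  shows "continuous_on {0..T} (\<lambda>t. picard u0 g n t x)"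
  using \<open>x \<in> V\<close>
proof (induction n arbitrary: x)
  case (Suc n)
  then have "continuous_on {0..T} (\<lambda>s. g (picard u0 g n s) x)"
    by (intro continuous_on_lipschitz_field[OF assms(1,2)]) auto
  then show ?case
    by (auto simp: picard.simps(2)
        intro!: continuous_intros indefinite_integral_continuous_1 integrable_continuous_real)
qed simp

text \<open>Each integration turns the Lipschitz bound \<open>L\<close> and the previous power of \<open>L * t\<close> into the next
  power over the next factorial. The constant bounds the first increment, the integral of \<open>g u0\<close>.\<close>

lemma l1dist_picard_Suc_le:
  assumes V: "finite V" and g: "lipschitz_field V L g" and t: "t \<in> {0..T}"
  shows "l1dist V (picard u0 g (Suc n) t) (picard u0 g n t)
           \<le> T * l1dist V (g u0) (\<lambda>_. 0) * (L * t) ^ n / fact n"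
  using t
proof (induction n arbitrary: t)
  case 0
  then show ?case
    by (simp add: picard.simps(2) l1dist_def mult_right_mono sum_nonneg flip: sum_distrib_left)
next
  case (Suc n)
  define K where "K = T * l1dist V (g u0) (\<lambda>_. 0)"
  let ?p = "picard u0 g"
  have cont: "continuous_on {0..t} (\<lambda>s. g (?p m s) x)" if "x \<in> V" for m x
    using that by (intro continuous_on_lipschitz_field[OF V g] continuous_on_picard[OF V g])
  have step: "norm (?p (Suc (Suc n)) t x - ?p (Suc n) t x)
      \<le> integral {0..t} (\<lambda>s. norm (g (?p (Suc n) s) x - g (?p n s) x))" if "x \<in> V" for x
  proof -
    have "?p (Suc (Suc n)) t x - ?p (Suc n) t x
        = integral {0..t} (\<lambda>s. g (?p (Suc n) s) x - g (?p n s) x)"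
      using cont[OF that]
      by (simp add: picard.simps(2)[of _ _ _ t] integral_diff integrable_continuous_real)
    also have "norm \<dots> \<le> integral {0..t} (\<lambda>s. norm (g (?p (Suc n) s) x - g (?p n s) x))"
      using cont[OF that]
      by (intro integral_norm_bound_integral integrable_continuous_real continuous_intros) auto
    finally show ?thesis .
  qed
  have "l1dist V (?p (Suc (Suc n)) t) (?p (Suc n) t)
      \<le> (\<Sum>x\<in>V. integral {0..t} (\<lambda>s. norm (g (?p (Suc n) s) x - g (?p n s) x)))"
    unfolding l1dist_def by (rule sum_mono) (rule step)
  also have "\<dots> = integral {0..t} (\<lambda>s. l1dist V (g (?p (Suc n) s)) (g (?p n s)))"
    unfolding l1dist_def using cont
    by (intro integral_sum[symmetric] V integrable_continuous_real continuous_intros)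
  also have "\<dots> \<le> integral {0..t} (\<lambda>s. L * (K * (L * s) ^ n / fact n))"
  proof (rule integral_le)
    show "(\<lambda>s. l1dist V (g (?p (Suc n) s)) (g (?p n s))) integrable_on {0..t}"
      unfolding l1dist_def using cont by (intro integrable_continuous_real continuous_intros)
    show "(\<lambda>s. L * (K * (L * s) ^ n / fact n)) integrable_on {0..t}"
      by (intro integrable_continuous_real continuous_intros) auto
    fix s assume s: "s \<in> {0..t}"
    have "l1dist V (g (?p (Suc n) s)) (g (?p n s)) \<le> L * l1dist V (?p (Suc n) s) (?p n s)"
      using g by (simp add: lipschitz_field_def)
    also have "\<dots> \<le> L * (K * (L * s) ^ n / fact n)"
      using Suc.IH[of s] Suc.prems s g
      by (intro mult_left_mono) (simp_all add: lipschitz_field_def K_def)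
    finally show "l1dist V (g (?p (Suc n) s)) (g (?p n s)) \<le> L * (K * (L * s) ^ n / fact n)" .
  qed
  also have "\<dots> = K * (L * t) ^ Suc n / fact (Suc n)"
  proof -
    let ?c = "K * L ^ Suc n / fact (Suc n)"
    have "((\<lambda>s. ?c * s ^ Suc n) has_real_derivative L * (K * (L * s) ^ n / fact n))
        (at s within {0..t})" for s
    proof -
      have "((\<lambda>s. ?c * s ^ Suc n) has_real_derivative ?c * (real (Suc n) * s ^ (Suc n - Suc 0)))
          (at s within {0..t})"
        by (rule DERIV_cmult[OF DERIV_pow])
      moreover have "?c * (real (Suc n) * s ^ (Suc n - Suc 0)) = L * (K * (L * s) ^ n / fact n)"
        by (simp add: power_mult_distrib del: of_nat_Suc)
      ultimately show ?thesis by (simp only:)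
    qed
    then have "((\<lambda>s. L * (K * (L * s) ^ n / fact n)) has_integral
        ?c * t ^ Suc n - ?c * 0 ^ Suc n) {0..t}"
      using Suc.prems
      by (intro fundamental_theorem_of_calculus)
        (auto simp flip: has_real_derivative_iff_has_vector_derivative)
    moreover have "?c * t ^ Suc n - ?c * 0 ^ Suc n = K * (L * t) ^ Suc n / fact (Suc n)"
      by (simp add: power_mult_distrib)
    ultimately have "((\<lambda>s. L * (K * (L * s) ^ n / fact n)) has_integral
        K * (L * t) ^ Suc n / fact (Suc n)) {0..t}"
      by (simp only:)
    then show ?thesis by (rule integral_unique)
  qed
  finally show ?case by (simp only: K_def)
qed

text \<open>The increments of the iterates are dominated by an exponential series, so the telescoping
  series converges uniformly by the Weierstrass test.\<close>

lemma picard_uniform_limit: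
  assumes V: "finite V" and g: "lipschitz_field V L g" and x: "x \<in> V"
  shows "uniform_limit {0..T} (\<lambda>n t. picard u0 g n t x)
           (\<lambda>t. u0 x + (\<Sum>n. picard u0 g (Suc n) t x - picard u0 g n t x)) sequentially"
proof -
  define K where "K = T * l1dist V (g u0) (\<lambda>_. 0)"
  let ?d = "\<lambda>n t. picard u0 g (Suc n) t x - picard u0 g n t x"
  have "norm (?d n t) \<le> K * (L * T) ^ n / fact n" if t: "t \<in> {0..T}" for n t
  proof -
    have "norm (?d n t) \<le> K * (L * t) ^ n / fact n"
      using norm_le_l1dist[OF V x] l1dist_picard_Suc_le[OF V g t] unfolding K_def
      by (rule order_trans)
    also have "\<dots> \<le> K * (L * T) ^ n / fact n"
      using t g by (intro divide_right_mono mult_left_mono power_mono mult_nonneg_nonneg)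
        (auto simp: lipschitz_field_def K_def l1dist_nonneg)
    finally show ?thesis .
  qed
  moreover have "summable (\<lambda>n. K * (L * T) ^ n / fact n)"
    using summable_mult[OF summable_exp[of "L * T"], of K] by (simp add: field_simps)
  ultimately have "uniform_limit {0..T} (\<lambda>n t. \<Sum>i<n. ?d i t) (\<lambda>t. \<Sum>i. ?d i t) sequentially"
    by (rule Weierstrass_m_test)
  then have "uniform_limit {0..T} (\<lambda>n t. u0 x + (\<Sum>i<n. ?d i t)) (\<lambda>t. u0 x + (\<Sum>i. ?d i t)) sequentially"
    by (intro uniform_limit_intros)
  moreover have "u0 x + (\<Sum>i<n. ?d i t) = picard u0 g n t x" for n t
    using sum_lessThan_telescope[of "\<lambda>n. picard u0 g n t x" n] by simp
  ultimately show ?thesis by simp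
qed

text \<open>The limit of the Picard iterates does not depend on the time horizon \<open>T\<close>, which is why it
  solves the equation for all times; the integral equation passes to the limit because \<open>g\<close>
  preserves uniform convergence.\<close>

theorem lipschitz_field_solution_exists:
  fixes g :: "('v \<Rightarrow> 'b::banach) \<Rightarrow> 'v \<Rightarrow> 'b"
  assumes V: "finite V" and g: "lipschitz_field V L g"
  obtains u where "\<And>x. x \<in> V \<Longrightarrow> u 0 x = u0 x"
    and "\<And>t x. 0 \<le> t \<Longrightarrow> x \<in> V \<Longrightarrow>
          ((\<lambda>s. u s x) has_vector_derivative g (u t) x) (at t within {0..})"
proof
  let ?p = "picard u0 g"
  define u where "u t x = u0 x + (\<Sum>n. ?p (Suc n) t x - ?p n t x)" for t x
  have lim: "uniform_limit {0..T} (\<lambda>n t. ?p n t x) (\<lambda>t. u t x) sequentially" if "x \<in> V" for T x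
    unfolding u_def by (rule picard_uniform_limit[OF V g that])
  have cont: "continuous_on {0..T} (\<lambda>t. u t x)" if "x \<in> V" for T x
    using lim[OF that] continuous_on_picard[OF V g that]
    by (intro uniform_limit_theorem[where F = sequentially]) auto
  have contg: "continuous_on {0..T} (\<lambda>t. g (u t) x)" if "x \<in> V" for T x
    by (rule continuous_on_lipschitz_field[OF V g that cont])
  have limg: "uniform_limit {0..T} (\<lambda>n t. g (?p n t) x) (\<lambda>t. g (u t) x) sequentially"
    if x: "x \<in> V" for T x
  proof (rule uniform_limitI)
    fix e :: real assume e: "0 < e"
    define d where "d = e / (L * card V + 1)"
    have L: "0 \<le> L * card V" using g by (simp add: lipschitz_field_def)
    then have d: "0 < d" using e by (simp add: d_def)
    have "\<forall>\<^sub>F n in sequentially. \<forall>y\<in>V. \<forall>t\<in>{0..T}. dist (?p n t y) (u t y) < d"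
      using uniform_limitD[OF lim d] V by (simp add: eventually_ball_finite)
    then show "\<forall>\<^sub>F n in sequentially. \<forall>t\<in>{0..T}. dist (g (?p n t) x) (g (u t) x) < e"
    proof (rule eventually_mono, intro ballI)
      fix n t assume *: "\<forall>y\<in>V. \<forall>t\<in>{0..T}. dist (?p n t y) (u t y) < d" and t: "t \<in> {0..T}"
      have "dist (g (?p n t) x) (g (u t) x) \<le> L * l1dist V (?p n t) (u t)"
        unfolding dist_norm by (rule lipschitz_field_norm_le[OF V g x])
      also have "l1dist V (?p n t) (u t) \<le> card V * d"
        unfolding l1dist_def dist_norm[symmetric]
        using * t by (intro sum_bounded_above) (auto intro: less_imp_le)
      also have "L * (card V * d) < e"
        using L e by (simp add: d_def field_simps)
      finally show "dist (g (?p n t) x) (g (u t) x) < e"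
        using g by (simp add: lipschitz_field_def mult_left_mono)
    qed
  qed
  have int: "u t x = u0 x + integral {0..t} (\<lambda>s. g (u s) x)" if x: "x \<in> V" and t: "0 \<le> t" for t x
  proof -
    have "continuous_on {0..t} (\<lambda>s. g (?p n s) x)" for n
      by (rule continuous_on_lipschitz_field[OF V g x continuous_on_picard[OF V g]])
    then obtain I J where IJ: "\<And>n. ((\<lambda>s. g (?p n s) x) has_integral I n) {0..t}"
      "((\<lambda>s. g (u s) x) has_integral J) {0..t}" "I \<longlonglongrightarrow> J"
      using uniform_limit_integral[OF limg[OF x]] by (metis sequentially_bot)
    have "(\<lambda>n. ?p (Suc n) t x) \<longlonglongrightarrow> u0 x + J"
      unfolding picard.simps(2) integral_unique[OF IJ(1)] by (intro tendsto_intros IJ(3))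
    moreover have "(\<lambda>n. ?p (Suc n) t x) \<longlonglongrightarrow> u t x"
      using tendsto_uniform_limitI[OF lim[OF x, of t], of t] t by (intro LIMSEQ_Suc) simp
    ultimately show ?thesis
      using IJ(2) by (metis LIMSEQ_unique integral_unique)
  qed
  show "u 0 x = u0 x" if "x \<in> V" for x
    using int[OF that, of 0] by simp
  show "((\<lambda>s. u s x) has_vector_derivative g (u t) x) (at t within {0..})"
    if t: "0 \<le> t" and x: "x \<in> V" for t x
  proof -
    have "((\<lambda>s. u0 x + integral {0..s} (\<lambda>s. g (u s) x)) has_vector_derivative 0 + g (u t) x)
        (at t within {0..t + 1})"
      using t by (intro has_vector_derivative_add has_vector_derivative_const
          integral_has_vector_derivative contg x) auto
    then have "((\<lambda>s. u0 x + integral {0..s} (\<lambda>s. g (u s) x)) has_vector_derivative g (u t) x)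
        (at t within {0..t + 1})"
      by simp
    then have "((\<lambda>s. u s x) has_vector_derivative g (u t) x) (at t within {0..t + 1})"
      by (rule has_vector_derivative_transform[rotated 2]) (use t int[OF x] in auto)
    \<comment> \<open>the horizon \<open>t + 1\<close> leaves room on the right of \<open>t\<close>, so it is invisible to the derivative\<close>
    moreover have "at t within {0..t + 1} = at t within {0..}"
      by (rule at_within_nhd[of _ "{..<t + 1}"]) auto
    ultimately show ?thesis by simp
  qed
qed

text \<open>A solution moves by at most \<open>M * h\<close> in one step, so its derivative varies by a multiple of
  \<open>h\<close> and the scheme makes an error of order \<open>h\<^sup>2\<close> per step. Earlier errors grow by the factor
  \<open>1 + L * h\<close>. Over the at most \<open>T / h\<close> steps this adds up to a multiple of \<open>h\<close>.\<close>

theorem euler_scheme_error: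
  fixes g :: "('v \<Rightarrow> 'b::real_normed_vector) \<Rightarrow> 'v \<Rightarrow> 'b" and M :: real
  assumes V: "finite V" and g: "lipschitz_field V L g"
    and M: "\<And>w x. x \<in> V \<Longrightarrow> norm (g w x) \<le> M"
    and u: "\<And>t x. 0 \<le> t \<Longrightarrow> x \<in> V \<Longrightarrow>
          ((\<lambda>s. u s x) has_vector_derivative g (u t) x) (at t within {0..})"
    and U0: "\<And>x. x \<in> V \<Longrightarrow> U 0 x = u 0 x"
    and USuc: "\<And>k x. x \<in> V \<Longrightarrow> U (Suc k) x = U k x + h *\<^sub>R g (U k) x"
    and h: "0 < h" and T: "h * real k \<le> T"
  shows "l1dist V (U k) (u (h * real k)) \<le> T * exp (L * T) * (card V * (L * (card V * M))) * h"
proof -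
  define K where "K = card V * (L * (card V * M))"
  have L: "0 \<le> L" using g by (simp add: lipschitz_field_def)
  have K: "0 \<le> K"
  proof (cases "V = {}")
    case False
    then obtain x where "x \<in> V" by blast
    then have "0 \<le> M" using order_trans[OF norm_ge_zero M] by blast
    then show ?thesis using L by (simp add: K_def)
  qed (simp add: K_def)
  have increment: "norm (u s x - u t x) \<le> M * \<bar>s - t\<bar>" if "0 \<le> s" "0 \<le> t" "x \<in> V" for s t x
    using that u M
    by (intro vector_differentiable_bound[where A = "{0..}" and f' = "\<lambda>t. g (u t) x"]) auto
  have local_error: "norm (u (t + h) x - u t x - h *\<^sub>R g (u t) x) \<le> h * (L * (card V * (M * h)))"
    if t: "0 \<le> t" and x: "x \<in> V" for t x
  proof -
    have "norm (u (t + h) x - u t x - (t + h - t) *\<^sub>R g (u t) x)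
        \<le> norm (t + h - t) * (L * (card V * (M * h)))"
    proof (rule vector_differentiable_bound_linearization
        [where S = "{t..t + h}" and f' = "\<lambda>t. g (u t) x"])
      fix s assume s: "s \<in> {t..t + h}"
      show "((\<lambda>s. u s x) has_vector_derivative g (u s) x) (at s within {t..t + h})"
        using u[OF _ x, of s] s t by (auto intro: has_vector_derivative_within_subset)
      have "M * \<bar>s - t\<bar> \<le> M * h"
        using s order_trans[OF norm_ge_zero M[OF x, of "u t"]] by (intro mult_left_mono) auto
      then have "l1dist V (u s) (u t) \<le> card V * (M * h)"
        unfolding l1dist_def using s t increment[of s t]
        by (intro sum_bounded_above) (force intro: order_trans)
      then show "norm (g (u s) x - g (u t) x) \<le> L * (card V * (M * h))"
        using lipschitz_field_norm_le[OF V g x, of "u s" "u t"] L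
        by (meson mult_left_mono order_trans)
    qed (use h in \<open>auto simp: closed_segment_eq_real_ivl\<close>)
    then show ?thesis using h by simp
  qed
  have "l1dist V (U k) (u (h * real k)) \<le> real k * (K * h\<^sup>2) * (1 + L * h) ^ k"
  proof (induction k)
    case 0
    then show ?case by (simp add: l1dist_def U0)
  next
    case (Suc k)
    define t where "t = h * real k"
    have t: "0 \<le> t" "h * real (Suc k) = t + h"
      using h by (auto simp: t_def algebra_simps)
    have "l1dist V (U (Suc k)) (u (t + h))
        \<le> (\<Sum>x\<in>V. (norm (U k x - u t x) + h * norm (g (U k) x - g (u t) x))
              + h * (L * (card V * (M * h))))"
      unfolding l1dist_def
    proof (rule sum_mono)
      fix x assume x: "x \<in> V"
      have "U (Suc k) x - u (t + h) x = (U k x - u t x) + h *\<^sub>R (g (U k) x - g (u t) x)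
          - (u (t + h) x - u t x - h *\<^sub>R g (u t) x)"
        by (simp add: USuc[OF x] algebra_simps)
      also have "norm \<dots> \<le> (norm (U k x - u t x) + norm (h *\<^sub>R (g (U k) x - g (u t) x)))
          + norm (u (t + h) x - u t x - h *\<^sub>R g (u t) x)"
        by (intro order_trans[OF norm_triangle_ineq4] add_right_mono norm_triangle_ineq)
      finally show "norm (U (Suc k) x - u (t + h) x)
          \<le> (norm (U k x - u t x) + h * norm (g (U k) x - g (u t) x)) + h * (L * (card V * (M * h)))"
        using local_error[OF t(1) x] h by simp
    qed
    also have "\<dots> = l1dist V (U k) (u t) + h * l1dist V (g (U k)) (g (u t)) + K * h\<^sup>2"
      by (simp add: l1dist_def sum.distrib K_def power2_eq_square flip: sum_distrib_left)
    also have "\<dots> \<le> l1dist V (U k) (u t) + h * (L * l1dist V (U k) (u t)) + K * h\<^sup>2"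
      using g h by (simp add: lipschitz_field_def)
    also have "\<dots> = (1 + L * h) * l1dist V (U k) (u t) + K * h\<^sup>2"
      by (simp add: algebra_simps)
    also have "\<dots> \<le> (1 + L * h) * (real k * (K * h\<^sup>2) * (1 + L * h) ^ k)
        + K * h\<^sup>2 * (1 + L * h) ^ Suc k"
    proof (rule add_mono)
      show "(1 + L * h) * l1dist V (U k) (u t) \<le> (1 + L * h) * (real k * (K * h\<^sup>2) * (1 + L * h) ^ k)"
        using Suc.IH L h by (intro mult_left_mono) (auto simp: t_def)
      have "1 \<le> (1 + L * h) ^ Suc k"
        using L h by (intro one_le_power) simp
      then show "K * h\<^sup>2 \<le> K * h\<^sup>2 * (1 + L * h) ^ Suc k"
        using K mult_left_mono[of 1 "(1 + L * h) ^ Suc k" "K * h\<^sup>2"] by simp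
    qed
    also have "\<dots> = real (Suc k) * (K * h\<^sup>2) * (1 + L * h) ^ Suc k"
      by (simp add: algebra_simps)
    finally show ?case by (simp only: t)
  qed
  also have "\<dots> \<le> real k * (K * h\<^sup>2) * exp (L * T)"
  proof (rule mult_left_mono)
    have "(1 + L * h) ^ k \<le> exp (L * h) ^ k"
      using L h by (intro power_mono exp_ge_add_one_self) auto
    also have "\<dots> = exp (L * (h * real k))"
      by (simp add: mult_ac flip: exp_of_nat_mult)
    also have "\<dots> \<le> exp (L * T)"
      using T L by (simp add: mult_left_mono)
    finally show "(1 + L * h) ^ k \<le> exp (L * T)" .
  qed (use K in auto)
  also have "\<dots> = (h * real k) * (exp (L * T) * K * h)"
    by (simp add: power2_eq_square)
  also have "\<dots> \<le> T * (exp (L * T) * K * h)"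
    using T K h by (intro mult_right_mono) auto
  finally show ?thesis by (simp add: K_def mult_ac)
qed

text \<open>Gronwall's argument: the squared distance \<open>\<phi>\<close> of the two solutions satisfies
  \<open>\<phi>' \<le> c * \<phi>\<close>, so \<open>\<phi> t * exp (- c * t)\<close> does not increase from its initial value 0. The
  Lipschitz bound is demanded along the two solutions only, because the replicator field, being
  cubic, satisfies it on the simplex but not globally.\<close>

theorem lipschitz_solution_unique:
  fixes u w :: "real \<Rightarrow> 'v \<Rightarrow> 'b::real_inner"
  assumes V: "finite V"
    and u: "\<And>t x. 0 \<le> t \<Longrightarrow> x \<in> V \<Longrightarrow>
          ((\<lambda>s. u s x) has_vector_derivative u' t x) (at t within {0..})"
    and w: "\<And>t x. 0 \<le> t \<Longrightarrow> x \<in> V \<Longrightarrow>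
          ((\<lambda>s. w s x) has_vector_derivative w' t x) (at t within {0..})"
    and K: "\<And>t x. 0 \<le> t \<Longrightarrow> x \<in> V \<Longrightarrow> norm (u' t x - w' t x) \<le> K * l1dist V (u t) (w t)"
    and init: "\<And>x. x \<in> V \<Longrightarrow> u 0 x = w 0 x"
    and t: "0 \<le> t" and x: "x \<in> V"
  shows "u t x = w t x"
proof -
  define \<phi> where "\<phi> s = (\<Sum>x\<in>V. (u s x - w s x) \<bullet> (u s x - w s x))" for s
  define \<phi>' where "\<phi>' s = (\<Sum>x\<in>V. 2 * ((u s x - w s x) \<bullet> (u' s x - w' s x)))" for s
  define c where "c = 2 * \<bar>K\<bar> * card V"
  have deriv: "(\<phi> has_real_derivative \<phi>' s) (at s within {0..})" if "0 \<le> s" for s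
    unfolding has_real_derivative_iff_has_vector_derivative \<phi>_def \<phi>'_def
  proof (intro has_vector_derivative_sum)
    fix x assume x: "x \<in> V"
    have "((\<lambda>s. u s x - w s x) has_vector_derivative u' s x - w' s x) (at s within {0..})"
      by (intro has_vector_derivative_diff u w that x)
    from bounded_bilinear.has_vector_derivative[OF bounded_bilinear_inner this this]
    show "((\<lambda>s. (u s x - w s x) \<bullet> (u s x - w s x)) has_vector_derivative
        2 * ((u s x - w s x) \<bullet> (u' s x - w' s x))) (at s within {0..})"
      by (simp add: inner_commute)
  qed
  have growth: "\<phi>' s \<le> c * \<phi> s" if s: "0 \<le> s" for s
  proof -
    define d where "d = l1dist V (u s) (w s)"
    have d: "0 \<le> d" by (simp add: d_def l1dist_nonneg)
    have "\<phi>' s \<le> (\<Sum>x\<in>V. norm (u s x - w s x) * (2 * \<bar>K\<bar> * d))"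
      unfolding \<phi>'_def
    proof (rule sum_mono)
      fix x assume x: "x \<in> V"
      have "(u s x - w s x) \<bullet> (u' s x - w' s x) \<le> norm (u s x - w s x) * norm (u' s x - w' s x)"
        by (rule norm_cauchy_schwarz)
      also have "\<dots> \<le> norm (u s x - w s x) * (\<bar>K\<bar> * d)"
        using K[OF s x] d mult_right_mono[OF abs_ge_self[of K] d]
        by (intro mult_left_mono) (auto simp: d_def)
      finally show "2 * ((u s x - w s x) \<bullet> (u' s x - w' s x))
          \<le> norm (u s x - w s x) * (2 * \<bar>K\<bar> * d)" by simp
    qed
    also have "\<dots> = 2 * \<bar>K\<bar> * d\<^sup>2"
      by (simp add: d_def l1dist_def power2_eq_square flip: sum_distrib_right)
    also have "\<dots> \<le> 2 * \<bar>K\<bar> * (\<phi> s * card V)"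
      unfolding d_def l1dist_def \<phi>_def power2_norm_eq_inner[symmetric]
      by (intro mult_left_mono sum_squared_le_sum_of_squares) simp
    finally show ?thesis by (simp add: c_def mult_ac)
  qed
  have "\<phi> t * exp (- c * t) \<le> \<phi> 0 * exp (- c * 0)"
  proof (rule DERIV_nonpos_imp_decreasing_open[OF t])
    show "\<exists>y. ((\<lambda>s. \<phi> s * exp (- c * s)) has_real_derivative y) (at s) \<and> y \<le> 0"
      if s: "0 < s" for s
    proof (intro exI conjI)
      have "at s within {0..} = at s"
        using s by (intro at_within_interior) (simp add: interior_real_atLeast)
      then have "(\<phi> has_real_derivative \<phi>' s) (at s)"
        using deriv[of s] s by simp
      then show "((\<lambda>s. \<phi> s * exp (- c * s)) has_real_derivative
          (\<phi>' s - c * \<phi> s) * exp (- c * s)) (at s)"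
        by (auto intro!: derivative_eq_intros simp: algebra_simps)
      show "(\<phi>' s - c * \<phi> s) * exp (- c * s) \<le> 0"
        using growth[of s] s by (simp add: mult_nonpos_nonneg)
    qed
    have "continuous_on {0..t} \<phi>"
      by (intro DERIV_continuous_on[where D = \<phi>'] has_field_derivative_subset[OF deriv]) auto
    then show "continuous_on {0..t} (\<lambda>s. \<phi> s * exp (- c * s))"
      by (intro continuous_intros)
  qed
  moreover have "\<phi> 0 = 0"
    by (simp add: \<phi>_def init)
  ultimately have "\<phi> t \<le> 0"
    by (simp add: mult_le_0_iff)
  moreover have "(u t x - w t x) \<bullet> (u t x - w t x) \<le> \<phi> t"
    unfolding \<phi>_def by (rule member_le_sum) (use V x in auto)
  ultimately show ?thesis
    by (metis eq_iff_diff_eq_0 inner_ge_zero inner_eq_zero_iff order.antisym order_trans)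
qed

section \<open>The nonlocal field on the assignment manifold\<close>

text \<open>Nodes outside the neighbourhood have weight 0, as no weight is negative.\<close>

lemma averaging_eq_sum:
  assumes "finite V" and "\<And>y. y \<in> V \<Longrightarrow> 0 \<le> \<Omega> x y"
  shows "averaging V \<Omega> S x = (\<Sum>y\<in>V. \<Omega> x y *\<^sub>R S y)"
  unfolding averaging_def neighbours_def
  by (rule sum.mono_neutral_left) (use assms in \<open>force simp: not_less intro: antisym\<close>)+

lemma averaging_cong:
  assumes "\<And>y. y \<in> V \<Longrightarrow> S y = S' y"
  shows "averaging V \<Omega> S x = averaging V \<Omega> S' x"
  using assms by (simp add: averaging_def neighbours_def)

lemma lipschitz_field_averaging:
  assumes V: "finite V" and \<Omega>: "\<And>x y. x \<in> V \<Longrightarrow> y \<in> V \<Longrightarrow> 0 \<le> \<Omega> x y"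
    and \<psi>: "\<And>v w. norm (\<psi> v - \<psi> w) \<le> c * norm (v - w)" and c: "0 \<le> c"
  shows "lipschitz_field V ((\<Sum>x\<in>V. \<Sum>y\<in>V. \<Omega> x y) * c)
           (\<lambda>u. averaging V \<Omega> (\<lambda>y. \<psi> (u y)))"
  unfolding lipschitz_field_def
proof (intro conjI allI)
  show "0 \<le> (\<Sum>x\<in>V. \<Sum>y\<in>V. \<Omega> x y) * c"
    using \<Omega> c by (intro mult_nonneg_nonneg sum_nonneg)
  fix u w
  have "norm (averaging V \<Omega> (\<lambda>y. \<psi> (u y)) x - averaging V \<Omega> (\<lambda>y. \<psi> (w y)) x)
      \<le> (\<Sum>y\<in>V. \<Omega> x y * (c * l1dist V u w))" if x: "x \<in> V" for x
  proof -
    have "averaging V \<Omega> (\<lambda>y. \<psi> (u y)) x - averaging V \<Omega> (\<lambda>y. \<psi> (w y)) x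
        = (\<Sum>y\<in>V. \<Omega> x y *\<^sub>R (\<psi> (u y) - \<psi> (w y)))"
      using V \<Omega> x by (simp add: averaging_eq_sum scaleR_diff_right sum_subtractf)
    also have "norm \<dots> \<le> (\<Sum>y\<in>V. \<Omega> x y * (c * l1dist V u w))"
    proof (rule sum_norm_le)
      fix y assume y: "y \<in> V"
      have "norm (\<psi> (u y) - \<psi> (w y)) \<le> c * l1dist V u w"
        using \<psi>[of "u y" "w y"] mult_left_mono[OF norm_le_l1dist[OF V y] c] by (rule order_trans)
      then show "norm (\<Omega> x y *\<^sub>R (\<psi> (u y) - \<psi> (w y))) \<le> \<Omega> x y * (c * l1dist V u w)"
        using \<Omega>[OF x y] by (simp add: mult_left_mono)
    qed
    finally show ?thesis .
  qed
  then have "l1dist V (averaging V \<Omega> (\<lambda>y. \<psi> (u y))) (averaging V \<Omega> (\<lambda>y. \<psi> (w y)))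
      \<le> (\<Sum>x\<in>V. \<Sum>y\<in>V. \<Omega> x y * (c * l1dist V u w))"
    unfolding l1dist_def[of V "averaging V \<Omega> (\<lambda>y. \<psi> (u y))"] by (rule sum_mono)
  then show "l1dist V (averaging V \<Omega> (\<lambda>y. \<psi> (u y))) (averaging V \<Omega> (\<lambda>y. \<psi> (w y)))
      \<le> (\<Sum>x\<in>V. \<Sum>y\<in>V. \<Omega> x y) * c * l1dist V u w"
    by (simp add: sum_distrib_right mult.assoc)
qed

lemma norm_averaging_le:
  assumes V: "finite V" and \<Omega>: "\<And>x y. x \<in> V \<Longrightarrow> y \<in> V \<Longrightarrow> 0 \<le> \<Omega> x y"
    and S: "\<And>y. y \<in> V \<Longrightarrow> norm (S y) \<le> 1" and x: "x \<in> V"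
  shows "norm (averaging V \<Omega> S x) \<le> (\<Sum>x\<in>V. \<Sum>y\<in>V. \<Omega> x y)"
proof -
  have avg: "averaging V \<Omega> S x = (\<Sum>y\<in>V. \<Omega> x y *\<^sub>R S y)"
    by (rule averaging_eq_sum) (use V \<Omega> x in auto)
  have "norm (averaging V \<Omega> S x) \<le> (\<Sum>y\<in>V. \<Omega> x y)"
    unfolding avg
  proof (rule sum_norm_le)
    fix y assume y: "y \<in> V"
    show "norm (\<Omega> x y *\<^sub>R S y) \<le> \<Omega> x y"
      using mult_left_mono[OF S[OF y] \<Omega>[OF x y]] \<Omega>[OF x y] by simp
  qed
  also have "\<dots> \<le> (\<Sum>x\<in>V. \<Sum>y\<in>V. \<Omega> x y)"
    using V \<Omega> x by (intro member_le_sum[of x V "\<lambda>x. \<Sum>y\<in>V. \<Omega> x y"] sum_nonneg) auto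
  finally show ?thesis .
qed

text \<open>Product rule for Lipschitz bounds: first the replicator matrix changes with the averaged vector
  fixed, then the averaged vector changes.\<close>

lemma norm_replicator_averaging_diff_le:
  fixes p q :: "'v \<Rightarrow> real ^ 'c"
  assumes V: "finite V" and \<Omega>: "\<And>x y. x \<in> V \<Longrightarrow> y \<in> V \<Longrightarrow> 0 \<le> \<Omega> x y"
    and p: "\<And>y. y \<in> V \<Longrightarrow> norm (p y) \<le> 1" and q: "\<And>y. y \<in> V \<Longrightarrow> norm (q y) \<le> 1"
    and x: "x \<in> V"
  shows "norm (replicator (p x) *v averaging V \<Omega> p x - replicator (q x) *v averaging V \<Omega> q x)
           \<le> 5 * (\<Sum>x\<in>V. \<Sum>y\<in>V. \<Omega> x y) * l1dist V p q"
proof -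
  let ?a = "averaging V \<Omega> p x" and ?b = "averaging V \<Omega> q x" and ?s = "\<Sum>x\<in>V. \<Sum>y\<in>V. \<Omega> x y"
  have s: "0 \<le> ?s" using \<Omega> by (intro sum_nonneg)
  have a: "norm ?a \<le> ?s" by (rule norm_averaging_le[OF V \<Omega> p x])
  have "lipschitz_field V (?s * 1) (\<lambda>u. averaging V \<Omega> (\<lambda>y. (u y :: real ^ 'c)))"
    using V \<Omega> by (intro lipschitz_field_averaging) auto
  then have "l1dist V (averaging V \<Omega> p) (averaging V \<Omega> q) \<le> ?s * l1dist V p q"
    unfolding lipschitz_field_def by simp
  then have ab: "norm (?a - ?b) \<le> ?s * l1dist V p q"
    using norm_le_l1dist[OF V x] by (rule order_trans[rotated])
  have "replicator (p x) *v ?a - replicator (q x) *v ?b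
      = (replicator (p x) *v ?a - replicator (q x) *v ?a) + replicator (q x) *v (?a - ?b)"
    by (simp add: matrix_vector_mult_diff_distrib)
  also have "norm \<dots> \<le> 3 * norm ?a * norm (p x - q x) + 2 * norm (?a - ?b)"
    using norm_replicator_diff_le[OF p[OF x] q[OF x], of ?a] norm_replicator_le[OF q[OF x], of "?a - ?b"]
    by (intro order_trans[OF norm_triangle_ineq] add_mono)
  also have "\<dots> \<le> 3 * ?s * l1dist V p q + 2 * (?s * l1dist V p q)"
    using a ab s norm_le_l1dist[OF V x, of p q] by (intro add_mono mult_mono) auto
  finally show ?thesis by (simp add: mult_ac)
qed

text \<open>Interchanging the arguments reverses the signs of both \<open>\<alpha>\<close> and the difference of \<open>f\<close>, so the
  two halves of the divergence add up and cancel the factor \<open>1/2\<close>. Antisymmetry also forces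
  \<open>\<alpha> x x = 0\<close>, hence the diagonal weight comes entirely from \<open>lam\<close>.\<close>

lemma nonlocal_field_eq_averaging:
  fixes f :: "'v \<Rightarrow> 'b::real_vector"
  assumes V: "finite V" and VI: "finite (interaction_domain V \<alpha>)"
    and \<alpha>: "\<And>x y. x \<in> extended_domain V \<alpha> \<Longrightarrow> y \<in> extended_domain V \<alpha> \<Longrightarrow> \<alpha> y x = - \<alpha> x y"
    and \<Theta>: "\<And>x y. x \<in> extended_domain V \<alpha> \<Longrightarrow> y \<in> extended_domain V \<alpha> \<Longrightarrow> \<Theta> x y = \<Theta> y x"
    and \<Theta>0: "\<And>x y. x \<in> V \<Longrightarrow> y \<in> V \<Longrightarrow> 0 \<le> \<Theta> x y"
    and \<Omega>: "\<And>y. y \<in> V \<Longrightarrow> \<Omega> x y = (if x \<noteq> y then \<Theta> x y * (\<alpha> x y)\<^sup>2 else \<Theta> x x)"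
    and lam: "lam x = (\<Sum>y\<in>extended_domain V \<alpha>. \<Theta> x y * (\<alpha> x y)\<^sup>2) + \<Theta> x x"
    and f: "\<And>y. y \<in> interaction_domain V \<alpha> \<Longrightarrow> f y = 0"
    and x: "x \<in> V"
  shows "nonlocal_field V \<alpha> \<Theta> lam f x = averaging V \<Omega> f x"
proof -
  let ?E = "extended_domain V \<alpha>" and ?k = "\<lambda>y. \<Theta> x y * (\<alpha> x y)\<^sup>2"
  have E: "finite ?E" "V \<subseteq> ?E" "x \<in> ?E"
    using V VI x by (auto simp: extended_domain_def)
  have "nonlocal_div V \<alpha> (\<lambda>y z. \<Theta> y z *\<^sub>R nonlocal_grad \<alpha> f y z) x
      = (\<Sum>y\<in>?E. (2 * ?k y) *\<^sub>R (f y - f x))"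
    unfolding nonlocal_div_def nonlocal_grad_def
  proof (rule sum.cong[OF refl])
    fix y assume y: "y \<in> ?E"
    show "\<alpha> x y *\<^sub>R \<Theta> x y *\<^sub>R \<alpha> x y *\<^sub>R (f y - f x) - \<alpha> y x *\<^sub>R \<Theta> y x *\<^sub>R \<alpha> y x *\<^sub>R (f x - f y)
        = (2 * ?k y) *\<^sub>R (f y - f x)"
      unfolding \<alpha>[OF E(3) y] \<Theta>[OF y E(3)]
      by (simp add: algebra_simps power2_eq_square flip: scaleR_2)
  qed
  then have "nonlocal_field V \<alpha> \<Theta> lam f x = (\<Sum>y\<in>?E. ?k y *\<^sub>R (f y - f x)) + lam x *\<^sub>R f x"
    unfolding nonlocal_field_def by (simp add: scaleR_sum_right)
  also have "\<dots> = (\<Sum>y\<in>?E. ?k y *\<^sub>R f y) + \<Theta> x x *\<^sub>R f x"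
    by (simp add: lam scaleR_diff_right sum_subtractf scaleR_left_distrib flip: scaleR_sum_left)
  also have "(\<Sum>y\<in>?E. ?k y *\<^sub>R f y) = (\<Sum>y\<in>V. ?k y *\<^sub>R f y)"
    by (rule sum.mono_neutral_right) (use E f in \<open>auto simp: extended_domain_def\<close>)
  also have "\<dots> = (\<Sum>y\<in>V - {x}. ?k y *\<^sub>R f y)"
    using \<alpha>[OF E(3) E(3)] by (simp add: sum.remove[OF V x])
  also have "\<dots> = (\<Sum>y\<in>V - {x}. \<Omega> x y *\<^sub>R f y)"
    by (intro sum.cong) (auto simp: \<Omega>)
  also have "\<dots> + \<Theta> x x *\<^sub>R f x = (\<Sum>y\<in>V. \<Omega> x y *\<^sub>R f y)"
    by (simp add: sum.remove[OF V x] \<Omega>[OF x])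
  also have "\<dots> = averaging V \<Omega> f x"
    using \<Theta>0 x by (intro averaging_eq_sum[symmetric] V) (auto simp: \<Omega>)
  finally show ?thesis .
qed

section \<open>The smallest eigenvalue and the potential\<close>

text \<open>The bilinear form \<open>\<langle>u, A w\<rangle>\<close>. Scalar functions are the case of the reals as inner product
  space, so the spectral bound for scalars and its use for simplex-valued functions share one
  notion.\<close>

definition weighted_form ::
    "'v set \<Rightarrow> ('v \<Rightarrow> 'v \<Rightarrow> real) \<Rightarrow> ('v \<Rightarrow> 'b::real_inner) \<Rightarrow> ('v \<Rightarrow> 'b) \<Rightarrow> real" where
  "weighted_form V A u w = (\<Sum>x\<in>V. u x \<bullet> (\<Sum>y\<in>V. A x y *\<^sub>R w y))"

lemma weighted_form_commute:
  assumes "\<And>x y. x \<in> V \<Longrightarrow> y \<in> V \<Longrightarrow> A x y = A y x"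
  shows "weighted_form V A u w = weighted_form V A w u"
proof -
  have "weighted_form V A u w = (\<Sum>y\<in>V. \<Sum>x\<in>V. A x y * (u x \<bullet> w y))"
    unfolding weighted_form_def inner_sum_right inner_scaleR_right by (rule sum.swap)
  also have "\<dots> = weighted_form V A w u"
    unfolding weighted_form_def inner_sum_right inner_scaleR_right
    by (intro sum.cong refl) (simp add: assms inner_commute)
  finally show ?thesis .
qed

lemma weighted_form_add_scaleR:
  assumes "\<And>x y. x \<in> V \<Longrightarrow> y \<in> V \<Longrightarrow> A x y = A y x"
  shows "weighted_form V A (\<lambda>x. u x + s *\<^sub>R w x) (\<lambda>x. u x + s *\<^sub>R w x)
           = weighted_form V A u u + 2 * s * weighted_form V A w u + s\<^sup>2 * weighted_form V A w w"
proof -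
  have "weighted_form V A (\<lambda>x. u x + s *\<^sub>R w x) (\<lambda>x. u x + s *\<^sub>R w x)
      = weighted_form V A u u + s * weighted_form V A u w + s * weighted_form V A w u
          + s\<^sup>2 * weighted_form V A w w"
    by (simp add: weighted_form_def inner_sum_right sum_distrib_left sum.distrib
        inner_add_left inner_add_right power2_eq_square algebra_simps)
  then show ?thesis
    using weighted_form_commute[OF assms, where u = u and w = w] by simp
qed

text \<open>The polynomial attains its minimum at 0, where its derivative must vanish. This is the
  first-order condition used for the Rayleigh quotient.\<close>

lemma linear_term_eq_0:
  fixes b c :: real
  assumes "\<And>s. 0 \<le> 2 * s * b + s\<^sup>2 * c"
  shows "b = 0"
proof (rule ccontr)
  assume b: "b \<noteq> 0"
  define m where "m = \<bar>c\<bar> + 1"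
  have m: "0 < m" "c < m" by (auto simp: m_def)
  \<comment> \<open>evaluate at the minimizer of the polynomial with \<open>m\<close> in place of \<open>c\<close>\<close>
  have "0 \<le> 2 * (- b / m) * b + (- b / m)\<^sup>2 * c" by (rule assms)
  also have "\<dots> = b\<^sup>2 / m * (c / m - 2)"
    using m by (simp add: field_simps power2_eq_square)
  also have "\<dots> < 0"
    using m b by (intro mult_pos_neg) (auto simp: field_simps)
  finally show False by simp
qed

text \<open>In the product topology this set is a closed subset of a product of compact intervals, all but
  finitely many of them \<open>{0}\<close>, so Tychonoff's theorem applies.\<close>

lemma compact_unit_sphere:
  assumes V: "finite V"
  shows "compact {f :: 'v \<Rightarrow> real. (\<forall>x. x \<notin> V \<longrightarrow> f x = 0) \<and> (\<Sum>x\<in>V. (f x)\<^sup>2) = 1}"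
    (is "compact ?K")
proof -
  let ?B = "PiE UNIV (\<lambda>x. if x \<in> V then {- 1..1 :: real} else {0})"
  have "compactin (product_topology (\<lambda>_. euclidean) UNIV) ?B"
    unfolding compactin_PiE by auto
  then have "compact ?B"
    by (simp add: euclidean_product_topology)
  moreover have "closed {f :: 'v \<Rightarrow> real. (\<Sum>x\<in>V. (f x)\<^sup>2) = 1}"
    by (intro closed_Collect_eq continuous_intros continuous_on_product_coordinates)
  ultimately have "compact (?B \<inter> {f. (\<Sum>x\<in>V. (f x)\<^sup>2) = 1})"
    by (rule compact_Int_closed)
  moreover have "?B \<inter> {f. (\<Sum>x\<in>V. (f x)\<^sup>2) = 1} = ?K"
  proof -
    have "\<bar>f x\<bar> \<le> 1" if "(\<Sum>x\<in>V. (f x)\<^sup>2) = 1" "x \<in> V" for f :: "'v \<Rightarrow> real" and x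
      using member_le_sum[of x V "\<lambda>x. (f x)\<^sup>2"] that V by (simp add: abs_square_le_1)
    then show ?thesis
      by (fastforce simp: PiE_def Pi_def abs_le_iff split: if_splits)
  qed
  ultimately show ?thesis by simp
qed

text \<open>The quadratic form attains its minimum \<open>\<mu>\<close> on the unit sphere, and by homogeneity
  \<open>\<mu>\<close> bounds the Rayleigh quotient everywhere. Perturbing the minimizer in the direction of a
  coordinate function and reading off the linear term gives the eigenvalue equation.\<close>

lemma symmetric_min_eigenvalue_exists:
  assumes V: "finite V" "V \<noteq> {}"
    and A: "\<And>x y. x \<in> V \<Longrightarrow> y \<in> V \<Longrightarrow> A x y = A y x"
  obtains \<mu> where "is_eigenvalue V A \<mu>"
    and "\<And>f :: 'v \<Rightarrow> real. \<mu> * (\<Sum>x\<in>V. (f x)\<^sup>2) \<le> weighted_form V A f f"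
proof -
  let ?Q = "\<lambda>f :: 'v \<Rightarrow> real. weighted_form V A f f" and ?N = "\<lambda>f :: 'v \<Rightarrow> real. \<Sum>x\<in>V. (f x)\<^sup>2"
  let ?K = "{f :: 'v \<Rightarrow> real. (\<forall>x. x \<notin> V \<longrightarrow> f x = 0) \<and> ?N f = 1}"
  obtain v where v: "v \<in> V" using V by blast
  define e where "e x = (if x = v then 1 else 0 :: real)" for x
  have "?N e = (\<Sum>x\<in>V. if x = v then 1 else 0)"
    by (rule sum.cong) (auto simp: e_def)
  also have "\<dots> = 1"
    using V v by simp
  finally have "e \<in> ?K"
    using v by (auto simp: e_def)
  then have nonempty: "?K \<noteq> {}" by blast
  have "continuous_on UNIV ?Q"
    unfolding weighted_form_def
    by (intro continuous_on_sum continuous_on_inner continuous_on_scaleR continuous_on_const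
        continuous_on_product_coordinates)
  then have "continuous_on ?K ?Q"
    by (rule continuous_on_subset) simp
  from continuous_attains_inf[OF compact_unit_sphere[OF V(1)] nonempty this]
  obtain f where f: "f \<in> ?K" and min: "\<And>g. g \<in> ?K \<Longrightarrow> ?Q f \<le> ?Q g"
    by blast
  define \<mu> where "\<mu> = ?Q f"
  have rayleigh: "\<mu> * ?N g \<le> ?Q g" for g
  proof (cases "?N g = 0")
    case True
    then have "g x = 0" if "x \<in> V" for x
      using that V by (simp add: sum_nonneg_eq_0_iff)
    then show ?thesis by (simp add: weighted_form_def)
  next
    case False
    then have pos: "0 < ?N g" by (simp add: less_le sum_nonneg)
    define r where "r = 1 / sqrt (?N g)"
    have r: "r\<^sup>2 * ?N g = 1" using pos by (simp add: r_def power_divide)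
    define g' where "g' x = (if x \<in> V then r * g x else 0)" for x
    have "?N g' = r\<^sup>2 * ?N g"
      by (simp add: g'_def power_mult_distrib sum_distrib_left)
    then have "g' \<in> ?K" by (simp add: r) (simp add: g'_def)
    then have "\<mu> \<le> ?Q g'" unfolding \<mu>_def by (rule min)
    also have "?Q g' = r\<^sup>2 * ?Q g"
      by (simp add: weighted_form_def g'_def sum_distrib_left power2_eq_square mult_ac)
    finally have "\<mu> * ?N g \<le> r\<^sup>2 * ?Q g * ?N g"
      using pos by (intro mult_right_mono) auto
    also have "\<dots> = ?Q g" using r by (simp add: mult_ac)
    finally show ?thesis .
  qed
  have "(\<Sum>y\<in>V. A z y * f y) = \<mu> * f z" if z: "z \<in> V" for z
  proof -
    define e :: "'v \<Rightarrow> real" where "e x = (if x = z then 1 else 0)" for x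
    have e_mult: "e x * k x = (if x = z then k x else 0)" for k x
      by (simp add: e_def)
    have sum_e: "(\<Sum>x\<in>V. e x * k x) = k z" for k
      using V z by (simp add: e_mult)
    have N: "?N (\<lambda>x. f x + s *\<^sub>R e x) = 1 + 2 * s * f z + s\<^sup>2" for s
    proof -
      have "?N (\<lambda>x. f x + s *\<^sub>R e x)
          = ?N f + (\<Sum>x\<in>V. e x * (2 * s * f x)) + (\<Sum>x\<in>V. e x * (e x * s\<^sup>2))"
        unfolding sum.distrib[symmetric]
        by (rule sum.cong) (simp_all add: power2_eq_square algebra_simps)
      then show ?thesis
        using f by (simp only: sum_e) (simp add: e_def)
    qed
    have "0 \<le> 2 * s * ((\<Sum>y\<in>V. A z y * f y) - \<mu> * f z) + s\<^sup>2 * (?Q e - \<mu>)" for s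
    proof -
      have "weighted_form V A e f = (\<Sum>y\<in>V. A z y * f y)"
        unfolding weighted_form_def inner_real_def by (simp add: sum_e)
      then show ?thesis
        using rayleigh[of "\<lambda>x. f x + s *\<^sub>R e x"]
          weighted_form_add_scaleR[OF A, where u = f and w = e and s = s]
        unfolding N by (simp add: \<mu>_def algebra_simps)
    qed
    then have "(\<Sum>y\<in>V. A z y * f y) - \<mu> * f z = 0"
      by (rule linear_term_eq_0)
    then show ?thesis by simp
  qed
  moreover have "\<exists>x\<in>V. f x \<noteq> 0"
    using f by (force intro: ccontr)
  ultimately have "is_eigenvalue V A \<mu>"
    unfolding is_eigenvalue_def by blast
  then show thesis using rayleigh by (rule that)
qed

lemma min_eigenvalue_le_form:
  fixes f :: "'v \<Rightarrow> real"
  assumes V: "finite V" "V \<noteq> {}"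
    and A: "\<And>x y. x \<in> V \<Longrightarrow> y \<in> V \<Longrightarrow> A x y = A y x"
  shows "min_eigenvalue V A * (\<Sum>x\<in>V. (f x)\<^sup>2) \<le> weighted_form V A f f"
proof -
  obtain \<mu> where \<mu>: "is_eigenvalue V A \<mu>"
    and rayleigh: "\<And>f :: 'v \<Rightarrow> real. \<mu> * (\<Sum>x\<in>V. (f x)\<^sup>2) \<le> weighted_form V A f f"
    using symmetric_min_eigenvalue_exists[where A = A, OF V A] by blast
  have "min_eigenvalue V A = \<mu>"
    unfolding min_eigenvalue_def
  proof (rule Least_equality)
    show "is_eigenvalue V A \<mu>" by (rule \<mu>)
  next
    fix \<nu> assume "is_eigenvalue V A \<nu>"
    then obtain f x where x: "x \<in> V" "f x \<noteq> 0"
      and ev: "\<And>x. x \<in> V \<Longrightarrow> (\<Sum>y\<in>V. A x y * f y) = \<nu> * f x"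
      unfolding is_eigenvalue_def by blast
    have "\<mu> * (\<Sum>x\<in>V. (f x)\<^sup>2) \<le> weighted_form V A f f" by (rule rayleigh)
    also have "\<dots> = (\<Sum>x\<in>V. f x * (\<nu> * f x))"
      by (simp add: weighted_form_def ev)
    also have "\<dots> = \<nu> * (\<Sum>x\<in>V. (f x)\<^sup>2)"
      by (simp add: sum_distrib_left power2_eq_square mult_ac)
    finally show "\<mu> \<le> \<nu>"
      using x V sum_pos2[of V x "\<lambda>x. (f x)\<^sup>2"] by simp
  qed
  then show ?thesis using rayleigh by simp
qed

text \<open>The form is the sum of the scalar forms of the components of \<open>u\<close>.\<close>

lemma min_eigenvalue_le_form_cart:
  fixes u :: "'v \<Rightarrow> real ^ 'c"
  assumes V: "finite V" "V \<noteq> {}"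
    and A: "\<And>x y. x \<in> V \<Longrightarrow> y \<in> V \<Longrightarrow> A x y = A y x"
  shows "min_eigenvalue V A * (\<Sum>x\<in>V. (norm (u x))\<^sup>2) \<le> weighted_form V A u u"
proof -
  have "min_eigenvalue V A * (\<Sum>x\<in>V. (norm (u x))\<^sup>2)
      = (\<Sum>j\<in>UNIV. min_eigenvalue V A * (\<Sum>x\<in>V. (u x $ j)\<^sup>2))"
    unfolding power2_norm_eq_inner inner_vec_def sum_distrib_left[symmetric]
    by (subst sum.swap) (simp add: power2_eq_square)
  also have "\<dots> \<le> (\<Sum>j\<in>UNIV. weighted_form V A (\<lambda>x. u x $ j) (\<lambda>x. u x $ j))"
    by (intro sum_mono min_eigenvalue_le_form V A)
  also have "\<dots> = weighted_form V A u u"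
    unfolding weighted_form_def inner_vec_def by (subst sum.swap) simp
  finally show ?thesis .
qed

text \<open>The logarithm has slope at least 1 on the unit interval.\<close>

lemma ln_difference_ge:
  fixes a b :: real
  assumes "0 < a" "a \<le> 1" "0 < b" "b \<le> 1"
  shows "(a - b)\<^sup>2 \<le> (a - b) * (ln a - ln b)"
  using assms
proof (induction a b rule: linorder_wlog)
  case (le a b)
  have "ln (a / b) \<le> a / b - 1"
    using le by (intro ln_le_minus_one) auto
  then have "ln a - ln b \<le> (a - b) / b"
    using le by (simp add: ln_div diff_divide_distrib)
  also have "\<dots> \<le> a - b"
    using le mult_left_mono_neg[of b 1 "a - b"] by (simp add: pos_divide_le_eq)
  finally have "(a - b) * (a - b) \<le> (a - b) * (ln a - ln b)"
    using le by (intro mult_left_mono_neg) auto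
  then show ?case by (simp add: power2_eq_square)
next
  case (sym a b)
  then show ?case by (simp add: power2_commute algebra_simps)
qed

text \<open>The direction \<open>v\<close> is the difference of the logarithms of \<open>q\<close> and \<open>p\<close> up to the constant
  \<open>ln Z\<close>, which pairs to 0 with \<open>q - p\<close>. The inner product is thus the symmetrized
  Kullback-Leibler divergence of \<open>p\<close> and \<open>q\<close>, and the logarithm is expanding on the unit
  interval.\<close>

lemma lifting_exp_ascent:
  fixes p v :: "real ^ 'c"
  assumes pos: "\<And>j. 0 < p $ j" and sum: "(\<Sum>j\<in>UNIV. p $ j) = 1"
  defines "q \<equiv> lifting_exp p v"
  shows "(norm (q - p))\<^sup>2 \<le> (q - p) \<bullet> v"
proof -
  define Z where "Z = (\<Sum>i\<in>UNIV. p $ i * exp (v $ i))"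
  have Z: "0 < Z" unfolding Z_def by (rule sum_exp_pos[OF pos])
  have q: "0 < q $ j" "(\<Sum>j\<in>UNIV. q $ j) = 1" for j
    unfolding q_def by (simp_all add: lifting_exp_pos lifting_exp_sum_1 pos)
  have le1: "r $ j \<le> 1" if "\<And>j. 0 < r $ j" "(\<Sum>j\<in>UNIV. r $ j) = 1" for r :: "real ^ 'c" and j
    using member_le_sum[of j UNIV "\<lambda>j. r $ j"] that by (simp add: less_imp_le)
  have v: "v $ j = (ln (q $ j) - ln (p $ j)) + ln Z" for j
    using pos[of j] Z by (simp add: q_def lifting_exp_component ln_div ln_mult flip: Z_def)
  have "(norm (q - p))\<^sup>2 = (\<Sum>j\<in>UNIV. (q $ j - p $ j)\<^sup>2)"
    by (simp add: power2_norm_eq_inner inner_vec_def flip: power2_eq_square)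
  also have "\<dots> \<le> (\<Sum>j\<in>UNIV. (q $ j - p $ j) * (ln (q $ j) - ln (p $ j)))"
    using pos sum q le1 by (intro sum_mono ln_difference_ge) auto
  also have "\<dots> = (\<Sum>j\<in>UNIV. (q $ j - p $ j) * (ln (q $ j) - ln (p $ j))) + (\<Sum>j\<in>UNIV. q $ j - p $ j) * ln Z"
    by (simp add: sum_subtractf sum q)
  also have "\<dots> = (q - p) \<bullet> v"
    by (simp add: inner_vec_def v distrib_left sum.distrib sum_distrib_right)
  finally show ?thesis .
qed

text \<open>With \<open>d = q - p\<close>, the form changes by \<open>2 \<langle>d, \<Omega> p\<rangle> + \<langle>d, \<Omega> d\<rangle>\<close>. Multiplied by
  \<open>h\<close>, the first summand is at least twice and the second at least minus once the squared
  norm \<open>D\<close> of \<open>d\<close>.\<close>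

theorem potential_nonincreasing:
  fixes p q :: "'v \<Rightarrow> real ^ 'c"
  assumes V: "finite V" "V \<noteq> {}"
    and sym: "\<And>x y. x \<in> V \<Longrightarrow> y \<in> V \<Longrightarrow> \<Omega> x y = \<Omega> y x"
    and nonneg: "\<And>x y. x \<in> V \<Longrightarrow> y \<in> V \<Longrightarrow> 0 \<le> \<Omega> x y"
    and p: "\<And>x j. x \<in> V \<Longrightarrow> 0 < p x $ j" "\<And>x. x \<in> V \<Longrightarrow> (\<Sum>j\<in>UNIV. p x $ j) = 1"
    and q: "\<And>x. x \<in> V \<Longrightarrow> q x = lifting_exp (p x) (h *\<^sub>R averaging V \<Omega> p x)"
    and h: "0 < h" "h * \<bar>min_eigenvalue V \<Omega>\<bar> \<le> 1"
  shows "potential V \<Omega> q \<le> potential V \<Omega> p"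
proof -
  define d where "d x = q x - p x" for x
  define D where "D = (\<Sum>x\<in>V. (norm (d x))\<^sup>2)"
  have D: "0 \<le> D" by (simp add: D_def sum_nonneg)
  have pot: "potential V \<Omega> S = - (1/2) * weighted_form V \<Omega> S S" for S :: "'v \<Rightarrow> real ^ 'c"
    unfolding potential_def weighted_form_def using V nonneg by (simp add: averaging_eq_sum)
  have "D \<le> (\<Sum>x\<in>V. d x \<bullet> (h *\<^sub>R averaging V \<Omega> p x))"
    unfolding D_def d_def using p q by (intro sum_mono) (simp add: lifting_exp_ascent del: inner_scaleR_right)
  also have "\<dots> = h * weighted_form V \<Omega> d p"
    unfolding weighted_form_def using V nonneg by (simp add: averaging_eq_sum sum_distrib_left)
  finally have ascent: "D \<le> h * weighted_form V \<Omega> d p" .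
  have "- D \<le> - (h * \<bar>min_eigenvalue V \<Omega>\<bar> * D)"
    using mult_right_mono[OF h(2) D] by simp
  also have "\<dots> \<le> h * (min_eigenvalue V \<Omega> * D)"
    using h(1) D mult_right_mono[OF abs_ge_minus_self[of "min_eigenvalue V \<Omega>"] D]
      mult_left_mono[of "- \<bar>min_eigenvalue V \<Omega>\<bar> * D" "min_eigenvalue V \<Omega> * D" h]
    by (simp add: mult_ac)
  also have "\<dots> \<le> h * weighted_form V \<Omega> d d"
    unfolding D_def using h(1) by (intro mult_left_mono min_eigenvalue_le_form_cart V sym) auto
  finally have "0 \<le> h * (2 * weighted_form V \<Omega> d p + weighted_form V \<Omega> d d)"
    using ascent D by (simp add: algebra_simps)
  then have "0 \<le> 2 * weighted_form V \<Omega> d p + weighted_form V \<Omega> d d"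
    using h(1) by (simp add: zero_le_mult_iff)
  moreover have "weighted_form V \<Omega> q q
      = weighted_form V \<Omega> p p + 2 * weighted_form V \<Omega> d p + weighted_form V \<Omega> d d"
    using weighted_form_add_scaleR[OF sym, where u = p and w = d and s = 1] by (simp add: d_def)
  ultimately show ?thesis by (simp add: pot)
qed

section \<open>The assignment flow and its geometric Euler scheme\<close>

theorem proposition5p1:
  fixes V :: "('d::finite) lattice set"
    and \<alpha> \<Theta> \<Omega> :: "'d lattice \<Rightarrow> 'd lattice \<Rightarrow> real"
    and lam :: "'d lattice \<Rightarrow> real"
    and X :: "'d lattice \<Rightarrow> 'm::metric_space"
    and P :: "'c::finite \<Rightarrow> 'm"
    and \<rho> :: real
    and S0 :: "'d lattice \<Rightarrow> real ^ 'c"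
    and S :: "real \<Rightarrow> nat \<Rightarrow> 'd lattice \<Rightarrow> real ^ 'c"
  assumes "CARD('d) \<ge> 2"
    and "finite V" and "V \<noteq> {}" and "finite (interaction_domain V \<alpha>)"
    and "\<forall>x\<in>extended_domain V \<alpha>. \<forall>y\<in>extended_domain V \<alpha>. \<alpha> y x = - \<alpha> x y"
    and "\<forall>x\<in>extended_domain V \<alpha>. \<forall>y\<in>extended_domain V \<alpha>. \<Theta> x y = \<Theta> y x \<and> \<Theta> x y \<ge> 0"
    and "\<forall>x\<in>interaction_domain V \<alpha>. \<forall>y\<in>interaction_domain V \<alpha>. \<alpha> x y = 0"
    and "\<forall>x\<in>V. \<forall>y\<in>V. \<Omega> x y = (if x \<noteq> y then \<Theta> x y * (\<alpha> x y)\<^sup>2 else \<Theta> x x)"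
    and "\<forall>x\<in>V. lam x = (\<Sum>y\<in>extended_domain V \<alpha>. \<Theta> x y * (\<alpha> x y)\<^sup>2) + \<Theta> x x"
    and "\<rho> > 0"
    and "\<forall>x\<in>V. S0 x = lifting_exp 1 (- ((1 / \<rho>) *\<^sub>R distance_vector X P x))"
    and "\<forall>h>0. \<forall>x\<in>V. S h 0 x = S0 x"
    and "\<forall>h>0. \<forall>k. \<forall>x\<in>V.
           S h (Suc k) x = lifting_exp (S h k x) (h *\<^sub>R averaging V \<Omega> (S h k) x)"
  shows
    \<comment> \<open>the scheme stays in the assignment manifold and is a discretization of the
        nonlocal system\<close>
    "(\<forall>h>0. \<forall>k. S h k \<in> assignment_manifold V \<and>
        (\<forall>x\<in>V. S h (Suc k) x =
           lifting_exp (S h k x)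
             (h *\<^sub>R nonlocal_field V \<alpha> \<Theta> lam (zero_extension V (S h k)) x)))
     \<and>
     (\<exists>Sc. solves_nonlocal_system V \<alpha> \<Theta> lam S0 Sc \<and>
        (\<forall>Sc'. solves_nonlocal_system V \<alpha> \<Theta> lam S0 Sc' \<longrightarrow>
           (\<forall>t\<ge>0. \<forall>x\<in>extended_domain V \<alpha>. Sc' t x = Sc t x)) \<and>
        (\<forall>T>0. \<exists>C. \<forall>h>0. \<forall>k. h * real k \<le> T \<longrightarrow>
           (\<forall>x\<in>extended_domain V \<alpha>.
              norm (zero_extension V (S h k) x - Sc (h * real k) x) \<le> C * h)))
     \<and>
     (\<forall>h>0. min_eigenvalue V \<Omega> = 0 \<or> h \<le> 1 / \<bar>min_eigenvalue V \<Omega>\<bar> \<longrightarrow>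
        (\<forall>k. potential V \<Omega> (S h (Suc k)) \<le> potential V \<Omega> (S h k)))"
proof -
  define \<sigma> where "\<sigma> v = lifting_exp 1 v" for v :: "real ^ 'c"
  define g where "g u = averaging V \<Omega> (\<lambda>y. \<sigma> (u y))" for u :: "'d lattice \<Rightarrow> real ^ 'c"
  \<comment> \<open>\<open>g\<close> is the field of the lifted equation, with \<open>M\<close> as its bound and \<open>2 * M\<close> as its Lipschitz constant\<close>
  define v0 where "v0 x = - ((1 / \<rho>) *\<^sub>R distance_vector X P x)" for x
  define M where "M = (\<Sum>x\<in>V. \<Sum>y\<in>V. \<Omega> x y)"
  have V: "finite V" "V \<noteq> {}" and VI: "finite (interaction_domain V \<alpha>)"
    using assms by auto
  have sub: "x \<in> extended_domain V \<alpha>" if "x \<in> V" for x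
    using that by (simp add: extended_domain_def)
  have \<Omega>: "\<Omega> x y = (if x \<noteq> y then \<Theta> x y * (\<alpha> x y)\<^sup>2 else \<Theta> x x)" if "x \<in> V" "y \<in> V" for x y
    using assms(8) that by blast
  have \<Theta>: "\<Theta> x y = \<Theta> y x" "0 \<le> \<Theta> x y"
    if "x \<in> extended_domain V \<alpha>" "y \<in> extended_domain V \<alpha>" for x y
    using assms(6) that by blast+
  have \<alpha>: "\<alpha> y x = - \<alpha> x y" if "x \<in> extended_domain V \<alpha>" "y \<in> extended_domain V \<alpha>" for x y
    using assms(5) that by blast
  have nonneg: "0 \<le> \<Omega> x y" if "x \<in> V" "y \<in> V" for x y
    using \<Omega>[OF that] \<Theta>(2) sub that by simp
  have sym: "\<Omega> x y = \<Omega> y x" if "x \<in> V" "y \<in> V" for x y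
    using \<Omega>[OF that] \<Omega>[OF that(2,1)] \<Theta>(1)[OF sub sub, OF that] \<alpha>[OF sub sub, OF that] by simp
  have field: "nonlocal_field V \<alpha> \<Theta> lam f x = averaging V \<Omega> f x"
    if "x \<in> V" "\<And>y. y \<in> interaction_domain V \<alpha> \<Longrightarrow> f y = 0"
    for x and f :: "'d lattice \<Rightarrow> real ^ 'c"
    by (rule nonlocal_field_eq_averaging[where \<Omega> = \<Omega> and \<Theta> = \<Theta>,
          OF V(1) VI \<alpha> \<Theta>(1) \<Theta>(2)[OF sub sub] \<Omega>[OF that(1)] _ that(2,1)])
      (use that(1) assms(9) in auto)

  have one: "0 < (1 :: real ^ 'c) $ j" for j
    by simp
  have \<sigma>: "\<sigma> v \<in> open_simplex" "0 < \<sigma> v $ j" "(\<Sum>j\<in>UNIV. \<sigma> v $ j) = 1"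
    "norm (\<sigma> v) \<le> 1" "lifting_exp (\<sigma> v) w = \<sigma> (v + w)" "norm (\<sigma> v - \<sigma> w) \<le> 2 * norm (v - w)"
    for v w j
    unfolding \<sigma>_def
    by (intro lifting_exp_in_open_simplex lifting_exp_pos lifting_exp_sum_1 open_simplex_norm_le_1
        lifting_exp_add lifting_exp_Lipschitz one)+
  have g: "lipschitz_field V (M * 2) g"
    unfolding g_def M_def by (intro lipschitz_field_averaging V nonneg \<sigma>(6)) auto
  have g_bound: "norm (g u x) \<le> M" if "x \<in> V" for u x
    unfolding g_def M_def using V nonneg \<sigma>(4) that by (intro norm_averaging_le)

  obtain v where v0: "\<And>x. x \<in> V \<Longrightarrow> v 0 x = v0 x"
    and v: "\<And>t x. 0 \<le> t \<Longrightarrow> x \<in> V \<Longrightarrow>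
          ((\<lambda>s. v s x) has_vector_derivative g (v t) x) (at t within {0..})"
    using lipschitz_field_solution_exists[OF V(1) g, of v0] by blast
  \<comment> \<open>\<open>Sc\<close> is the continuous-time solution, and \<open>U h\<close> are the Euler iterates of the lifted equation\<close>
  define Sc where "Sc t x = (if x \<in> V then \<sigma> (v t x) else 0)" for t x
  define U where "U h = rec_nat v0 (\<lambda>_ u x. u x + h *\<^sub>R g u x)" for h

  have scheme: "S h k x = \<sigma> (U h k x)" if h: "0 < h" and x: "x \<in> V" for h k x
    using x
  proof (induction k arbitrary: x)
    case 0
    then show ?case
      using assms(11,12) h by (simp add: U_def v0_def \<sigma>_def)
  next
    case (Suc k)
    have "averaging V \<Omega> (S h k) x = g (U h k) x"
      unfolding g_def using Suc.IH by (rule averaging_cong)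
    then show ?case
      using assms(13) h Suc by (simp add: \<sigma>(5)) (simp add: U_def)
  qed

  have part1: "S h k \<in> assignment_manifold V \<and> (\<forall>x\<in>V. S h (Suc k) x =
      lifting_exp (S h k x) (h *\<^sub>R nonlocal_field V \<alpha> \<Theta> lam (zero_extension V (S h k)) x))"
    if h: "0 < h" for h k
  proof (intro conjI ballI)
    show "S h k \<in> assignment_manifold V"
      using scheme[OF h] \<sigma>(1) by (simp add: assignment_manifold_def)
    fix x assume x: "x \<in> V"
    have "nonlocal_field V \<alpha> \<Theta> lam (zero_extension V (S h k)) x
        = averaging V \<Omega> (zero_extension V (S h k)) x"
      by (rule field[OF x]) (simp add: zero_extension_def interaction_domain_def)
    also have "\<dots> = averaging V \<Omega> (S h k) x"
      by (rule averaging_cong) (simp add: zero_extension_def)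
    finally show "S h (Suc k) x =
        lifting_exp (S h k x) (h *\<^sub>R nonlocal_field V \<alpha> \<Theta> lam (zero_extension V (S h k)) x)"
      using assms(13) h x by simp
  qed

  have solves: "solves_nonlocal_system V \<alpha> \<Theta> lam S0 Sc"
    unfolding solves_nonlocal_system_def
  proof (intro conjI allI impI ballI)
    show "Sc t \<in> assignment_manifold V" for t
      using \<sigma>(1) by (simp add: Sc_def assignment_manifold_def)
    show "Sc 0 x = S0 x" if "x \<in> V" for x
      using that assms(11) by (simp add: Sc_def v0 v0_def \<sigma>_def)
    show "Sc t x = 0" if "x \<in> interaction_domain V \<alpha>" for t x
      using that by (simp add: Sc_def interaction_domain_def)
    fix t :: real and x assume t: "0 \<le> t" and x: "x \<in> V"
    have "nonlocal_field V \<alpha> \<Theta> lam (Sc t) x = averaging V \<Omega> (Sc t) x"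
      by (rule field[OF x]) (simp add: Sc_def interaction_domain_def)
    also have "\<dots> = g (v t) x"
      unfolding g_def by (rule averaging_cong) (simp add: Sc_def)
    finally show "((\<lambda>s. Sc s x) has_vector_derivative
        replicator (Sc t x) *v nonlocal_field V \<alpha> \<Theta> lam (Sc t) x) (at t within {0..})"
      using lifting_exp_has_derivative[OF v[OF t x] one] x by (simp add: Sc_def \<sigma>_def)
  qed

  have solution: "norm (R t x) \<le> 1" "((\<lambda>s. R s x) has_vector_derivative
        replicator (R t x) *v averaging V \<Omega> (R t) x) (at t within {0..})"
    if R: "solves_nonlocal_system V \<alpha> \<Theta> lam S0 R" and t: "0 \<le> t" and x: "x \<in> V" for R t x
  proof -
    have "R t x \<in> open_simplex" and boundary: "\<And>y. y \<in> interaction_domain V \<alpha> \<Longrightarrow> R t y = 0"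
      and deriv: "((\<lambda>s. R s x) has_vector_derivative
        replicator (R t x) *v nonlocal_field V \<alpha> \<Theta> lam (R t) x) (at t within {0..})"
      using R t x unfolding solves_nonlocal_system_def assignment_manifold_def by blast+
    then show "norm (R t x) \<le> 1"
      by (simp add: open_simplex_norm_le_1)
    show "((\<lambda>s. R s x) has_vector_derivative
        replicator (R t x) *v averaging V \<Omega> (R t) x) (at t within {0..})"
      using deriv field[of x "R t", OF x boundary] by simp
  qed
  have unique: "R t x = Sc t x"
    if R: "solves_nonlocal_system V \<alpha> \<Theta> lam S0 R" and t: "0 \<le> t" and x: "x \<in> extended_domain V \<alpha>"
    for R t x
  proof (cases "x \<in> V")
    case True
    show ?thesis
    proof (rule lipschitz_solution_unique[OF V(1) solution(2)[OF R] solution(2)[OF solves] _ _ t True])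
      show "norm (replicator (R t x) *v averaging V \<Omega> (R t) x
              - replicator (Sc t x) *v averaging V \<Omega> (Sc t) x)
          \<le> 5 * (\<Sum>x\<in>V. \<Sum>y\<in>V. \<Omega> x y) * l1dist V (R t) (Sc t)" if "0 \<le> t" "x \<in> V" for t x
        by (intro norm_replicator_averaging_diff_le V nonneg that(2)
            solution(1)[OF R that(1)] solution(1)[OF solves that(1)])
      show "R 0 x = Sc 0 x" if "x \<in> V" for x
        using R solves that unfolding solves_nonlocal_system_def by simp
    qed
  next
    case False
    then show ?thesis
      using R solves t x unfolding solves_nonlocal_system_def by (auto simp: extended_domain_def)
  qed

  have error: "\<exists>C. \<forall>h>0. \<forall>k. h * real k \<le> T \<longrightarrow> (\<forall>x\<in>extended_domain V \<alpha>.
      norm (zero_extension V (S h k) x - Sc (h * real k) x) \<le> C * h)" for T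
  proof (intro exI allI impI ballI)
    fix h :: real and k x assume h: "0 < h" and T: "h * real k \<le> T"
    let ?B = "T * exp (M * 2 * T) * (card V * (M * 2 * (card V * M))) * h"
    have dist: "l1dist V (U h k) (v (h * real k)) \<le> ?B"
      by (rule euler_scheme_error[OF V(1) g g_bound v _ _ h T]) (simp_all add: U_def v0)
    have "norm (zero_extension V (S h k) x - Sc (h * real k) x) \<le> 2 * ?B"
    proof (cases "x \<in> V")
      case True
      then have "norm (zero_extension V (S h k) x - Sc (h * real k) x)
          = norm (\<sigma> (U h k x) - \<sigma> (v (h * real k) x))"
        using scheme[OF h] by (simp add: zero_extension_def Sc_def)
      also have "\<dots> \<le> 2 * norm (U h k x - v (h * real k) x)"
        by (rule \<sigma>(6))
      also have "\<dots> \<le> 2 * ?B"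
        by (intro mult_left_mono order_trans[OF norm_le_l1dist[OF V(1) True] dist]) simp
      finally show ?thesis .
    next
      case False
      then show ?thesis
        using order_trans[OF l1dist_nonneg dist] by (simp add: zero_extension_def Sc_def)
    qed
    then show "norm (zero_extension V (S h k) x - Sc (h * real k) x)
        \<le> 2 * (T * exp (M * 2 * T) * (card V * (M * 2 * (card V * M)))) * h"
      by simp
  qed

  have monotone: "potential V \<Omega> (S h (Suc k)) \<le> potential V \<Omega> (S h k)"
    if h: "0 < h" and step: "min_eigenvalue V \<Omega> = 0 \<or> h \<le> 1 / \<bar>min_eigenvalue V \<Omega>\<bar>" for h k
  proof (rule potential_nonincreasing[OF V sym nonneg])
    show "h * \<bar>min_eigenvalue V \<Omega>\<bar> \<le> 1"
      using step by (cases "min_eigenvalue V \<Omega> = 0") (auto simp: pos_le_divide_eq)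
  qed (use assms(13) h scheme[OF h] \<sigma>(2,3) in auto)

  show ?thesis
    using part1 solves unique error monotone by blast
qed

end
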